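(* Let $L$ be a permutation group on a finite set $\Omega$. If $L$ is intransitive and graph-restrictive, then $L$ is semiregular.
   Context: All graphs are finite, simple and connected. For a graph $\Gamma$ and a subgroup $G\le \mathrm{Aut}(\Gamma)$ acting transitively on the vertex set, with $v$ a vertex, the pair $(\Gamma,G)$ is called locally-$L$ if the permutation group induced by the vertex-stabiliser $G_v$ on the neighbourhood $\Gamma(v)$ is permutation isomorphic to $L$ (this does not depend on $v$). A permutation group $L$ is graph-restrictive if there is a constant $c(L)$ such that for every locally-$L$ pair $(\Gamma,G)$ and every vertex $v$ of $\Gamma$ one has $|G_v|\le c(L)$. A permutation group is semiregular if all its point-stabilisers are trivial. *)

theory Defs
  imports "HOL-Algebra.Group_Action" "Graph_Theory.Digraph_Component"
begin

text \<open>
  Permutation groups on \<open>S\<close> are the subgroups of \<^const>\<open>BijGroup\<close> \<open>S\<close>. Their elements are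
  extensional functions, so that two permutations are equal iff they agree on \<open>S\<close>.
  The set \<open>H\<close> of permutations becomes a group acting on \<open>S\<close> by \<open>\<lambda>g. g\<close>.
\<close>

abbreviation perm_group :: "'a set \<Rightarrow> ('a \<Rightarrow> 'a) set \<Rightarrow> ('a \<Rightarrow> 'a) monoid" where
  "perm_group S H \<equiv> BijGroup S \<lparr>carrier := H\<rparr>"

abbreviation perm_transitive :: "'a set \<Rightarrow> ('a \<Rightarrow> 'a) set \<Rightarrow> bool" where
  "perm_transitive S H \<equiv> transitive_action (perm_group S H) S (\<lambda>g. g)"

abbreviation point_stabilizer :: "'a set \<Rightarrow> ('a \<Rightarrow> 'a) set \<Rightarrow> 'a \<Rightarrow> ('a \<Rightarrow> 'a) set" where
  "point_stabilizer S H x \<equiv> stabilizer (perm_group S H) (\<lambda>g. g) x"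

definition semiregular :: "'a set \<Rightarrow> ('a \<Rightarrow> 'a) set \<Rightarrow> bool" where
  "semiregular S H \<longleftrightarrow> (\<forall>x\<in>S. point_stabilizer S H x = {\<one>\<^bsub>BijGroup S\<^esub>})"

definition perm_isomorphic ::
    "'a set \<Rightarrow> ('a \<Rightarrow> 'a) set \<Rightarrow> 'b set \<Rightarrow> ('b \<Rightarrow> 'b) set \<Rightarrow> bool" where
  "perm_isomorphic S H T K \<longleftrightarrow>
     (\<exists>f \<phi>. bij_betw f S T \<and> \<phi> \<in> iso (perm_group S H) (perm_group T K) \<and>
        (\<forall>g\<in>H. \<forall>x\<in>S. f (g x) = \<phi> g (f x)))"

lemma group_action_perm_group:
  assumes "subgroup H (BijGroup S)"
  shows "group_action (perm_group S H) S (\<lambda>g. g)"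
  using subgroup.subgroup_is_group[OF assms group_BijGroup] subgroup.subset[OF assms]
  by (auto simp: group_action_def group_hom_def group_hom_axioms_def group_BijGroup hom_def)

lemma perm_transitive_iff:
  assumes "subgroup H (BijGroup S)"
  shows "perm_transitive S H \<longleftrightarrow> (\<forall>x\<in>S. \<forall>y\<in>S. \<exists>g\<in>H. g x = y)"
  using group_action_perm_group[OF assms]
  by (auto simp: transitive_action_def transitive_action_axioms_def)


text \<open>
  A finite simple graph is a \<^const>\<open>pair_graph\<close>: a finite vertex set together with a symmetric,
  irreflexive set of ordered pairs, an edge \<open>{u, v}\<close> being represented by both \<open>(u, v)\<close> and
  \<open>(v, u)\<close>.
\<close>

definition graph_auto :: "'v pair_pre_digraph \<Rightarrow> ('v \<Rightarrow> 'v) set" where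
  "graph_auto \<Gamma> = {g \<in> Bij (pverts \<Gamma>).
     \<forall>u\<in>pverts \<Gamma>. \<forall>v\<in>pverts \<Gamma>. (u, v) \<in> parcs \<Gamma> \<longleftrightarrow> (g u, g v) \<in> parcs \<Gamma>}"

definition GraphAutoGroup :: "'v pair_pre_digraph \<Rightarrow> ('v \<Rightarrow> 'v) monoid" where
  "GraphAutoGroup \<Gamma> = perm_group (pverts \<Gamma>) (graph_auto \<Gamma>)"

definition neighbourhood :: "'v pair_pre_digraph \<Rightarrow> 'v \<Rightarrow> 'v set" where
  "neighbourhood \<Gamma> v = {w. (v, w) \<in> parcs \<Gamma>}"

definition local_action ::
    "'v pair_pre_digraph \<Rightarrow> ('v \<Rightarrow> 'v) set \<Rightarrow> 'v \<Rightarrow> ('v \<Rightarrow> 'v) set" where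
  "local_action \<Gamma> G v =
     (\<lambda>g. restrict g (neighbourhood \<Gamma> v)) ` point_stabilizer (pverts \<Gamma>) G v"

text \<open>
  The condition on the local action is imposed at every vertex; by transitivity of \<open>G\<close> it
  is enough that it holds at one of them. A connected graph in the sense of
  \<^const>\<open>Digraph_Component.connected\<close> has at least one vertex.
\<close>

definition locally_pair ::
    "'a set \<Rightarrow> ('a \<Rightarrow> 'a) set \<Rightarrow> 'v pair_pre_digraph \<Rightarrow> ('v \<Rightarrow> 'v) set \<Rightarrow> bool" where
  "locally_pair S L \<Gamma> G \<longleftrightarrow>
     pair_graph \<Gamma> \<and> Digraph_Component.connected (with_proj \<Gamma>) \<and>
     subgroup G (GraphAutoGroup \<Gamma>) \<and> perm_transitive (pverts \<Gamma>) G \<and>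
     (\<forall>v\<in>pverts \<Gamma>. perm_isomorphic S L (neighbourhood \<Gamma> v) (local_action \<Gamma> G v))"

text \<open>
  HOL cannot quantify over all vertex types inside a definition. As every finite graph is
  isomorphic to one whose vertices are natural numbers, letting \<open>\<Gamma>\<close> range over the latter
  loses no generality.
\<close>

definition graph_restrictive :: "'a set \<Rightarrow> ('a \<Rightarrow> 'a) set \<Rightarrow> bool" where
  "graph_restrictive S L \<longleftrightarrow>
     (\<exists>c::nat. \<forall>(\<Gamma>::nat pair_pre_digraph) G. locally_pair S L \<Gamma> G \<longrightarrow>
        (\<forall>v\<in>pverts \<Gamma>. card (point_stabilizer (pverts \<Gamma>) G v) \<le> c))"


lemma subgroup_graph_auto: "subgroup (graph_auto \<Gamma>) (BijGroup (pverts \<Gamma>))"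
proof (rule group.subgroupI[OF group_BijGroup])
  show "graph_auto \<Gamma> \<subseteq> carrier (BijGroup (pverts \<Gamma>))"
    by (auto simp: graph_auto_def BijGroup_def)
  have "(\<lambda>x\<in>pverts \<Gamma>. x) \<in> graph_auto \<Gamma>"
    by (auto simp: graph_auto_def id_Bij)
  then show "graph_auto \<Gamma> \<noteq> {}" by blast
next
  fix g assume g: "g \<in> graph_auto \<Gamma>"
  let ?V = "pverts \<Gamma>"
  have b: "g \<in> Bij ?V" using g by (simp add: graph_auto_def)
  have e: "\<forall>u\<in>?V. \<forall>v\<in>?V. (u, v) \<in> parcs \<Gamma> \<longleftrightarrow> (g u, g v) \<in> parcs \<Gamma>"
    using g by (simp add: graph_auto_def)
  have m: "\<And>x. x \<in> ?V \<Longrightarrow> inv_into ?V g x \<in> ?V \<and> g (inv_into ?V g x) = x"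
    using b Bij_inv_into_mem[OF b] by (auto simp: Bij_def bij_betw_def f_inv_into_f)
  show "inv\<^bsub>BijGroup ?V\<^esub> g \<in> graph_auto \<Gamma>"
    unfolding inv_BijGroup[OF b] graph_auto_def
    using restrict_inv_into_Bij[OF b] m e by simp
next
  fix g h assume gh: "g \<in> graph_auto \<Gamma>" "h \<in> graph_auto \<Gamma>"
  let ?V = "pverts \<Gamma>"
  have b: "g \<in> Bij ?V" "h \<in> Bij ?V" using gh by (simp_all add: graph_auto_def)
  have m: "\<And>x. x \<in> ?V \<Longrightarrow> h x \<in> ?V" using Bij_imp_funcset[OF b(2)] by blast
  have "compose ?V g h \<in> graph_auto \<Gamma>"
    using gh m by (simp add: graph_auto_def compose_Bij compose_eq)
  then show "g \<otimes>\<^bsub>BijGroup ?V\<^esub> h \<in> graph_auto \<Gamma>"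
    using b by (simp add: BijGroup_def)
qed

end

theory Submission
  imports Defs "HOL-Algebra.Generated_Groups" "HOL-Algebra.Product_Groups"
begin

text \<open>
  Suppose that \<open>L\<close> is intransitive and that the stabiliser \<open>P\<close> of some point \<open>z\<close> is non-trivial;
  fix \<open>n\<close>. The group \<open>D = L \<times> P\<^sup>n\<close>, with coordinates \<open>0, \<dots>, n\<close>, acts on \<open>\<Omega>\<close> through its coordinate
  \<open>0\<close>, and will be a vertex stabiliser. For each orbit representative \<open>j\<close> we need an involution
  \<open>a\<^sub>j\<close> that reverses an edge and therefore normalises the stabiliser \<open>D\<^sub>j\<close>. As \<open>D\<^sub>z = P\<^bsup>n+1\<^esup>\<close>, we can let
  \<open>a\<^sub>z\<close> reverse all the coordinates \<open>0, \<dots>, n\<close>, while for \<open>j \<noteq> z\<close> we let \<open>a\<^sub>j\<close> reverse the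
  coordinates \<open>1, \<dots>, n\<close>. A subgroup of \<open>D\<close> that is normal in the group generated by \<open>D\<close> and all
  \<open>a\<^sub>j\<close> acts trivially on \<open>\<Omega>\<close>, so its coordinate \<open>0\<close> vanishes; since there is a second orbit, the
  two reversals propagate this to the coordinates \<open>n, 1, n - 1, 2, \<dots>\<close>, so it is trivial. A finite
  group \<open>K\<close> containing \<open>D\<close> and such involutions is found among the permutations of
  \<open>D \<times> Pow J\<close>, where \<open>J\<close> is the set of orbit representatives. The pair consisting of the
  coset graph on \<open>K / D\<close> and of \<open>K\<close> is then locally-\<open>L\<close> with vertex stabilisers of order
  \<open>|L| |P|\<^sup>n\<close>.
\<close>

section \<open>Permutation groups and their transport along a bijection\<close>

lemma BijGroup_simps:
  "carrier (BijGroup S) = Bij S" "\<one>\<^bsub>BijGroup S\<^esub> = (\<lambda>x\<in>S. x)"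
  "f \<in> Bij S \<Longrightarrow> g \<in> Bij S \<Longrightarrow> f \<otimes>\<^bsub>BijGroup S\<^esub> g = compose S f g"
  by (simp_all add: BijGroup_def)

lemma Bij_eqI:
  assumes "f \<in> Bij S" "g \<in> Bij S" "\<And>x. x \<in> S \<Longrightarrow> f x = g x"
  shows "f = g"
  using assms by (auto simp: Bij_def intro: extensionalityI)

lemma Bij_app: "f \<in> Bij S \<Longrightarrow> x \<in> S \<Longrightarrow> f x \<in> S"
  using Bij_imp_funcset by blast

text \<open>Conjugation with \<open>f\<close> turns permutations of \<open>S\<close> into
  permutations of \<open>T\<close>; this is the shape in which the local action of a coset graph
  appears. Restricting to \<open>T\<close> makes the conjugates extensional, as \<open>Bij T\<close>
  demands.\<close>

lemma perm_isomorphic_conjugate: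
  assumes L: "subgroup L (BijGroup S)" and f: "bij_betw f S T"
  shows "perm_isomorphic S L T ((\<lambda>l. \<lambda>w\<in>T. f (l (inv_into S f w))) ` L)"
proof -
  define \<phi> where "\<phi> = (\<lambda>l. \<lambda>w\<in>T. f (l (inv_into S f w)))"
  have LB: "l \<in> Bij S" if "l \<in> L" for l
    using subgroup.subset[OF L] that by (auto simp: BijGroup_simps)
  have inv: "inv_into S f w \<in> S" "f (inv_into S f w) = w" if "w \<in> T" for w
    using f that by (auto simp: bij_betw_def inv_into_into f_inv_into_f)
  have fT: "f x \<in> T" "inv_into S f (f x) = x" if "x \<in> S" for x
    using f that by (auto simp: bij_betw_def)
  have app: "\<phi> l (f x) = f (l x)" if "x \<in> S" for l x
    using fT that by (simp add: \<phi>_def)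
  have \<phi>B: "\<phi> l \<in> Bij T" if "l \<in> L" for l
  proof -
    have "bij_betw (f \<circ> l \<circ> inv_into S f) T T"
      using LB[OF that]
      by (intro bij_betw_trans[OF bij_betw_inv_into[OF f]] bij_betw_trans[OF _ f]) (simp add: Bij_def)
    then have "bij_betw (\<phi> l) T T"
      by (rule bij_betw_cong[THEN iffD1, rotated]) (simp add: \<phi>_def)
    then show ?thesis by (auto simp: Bij_def \<phi>_def)
  qed
  have eqI: "p = q" if "p \<in> Bij T" "q \<in> Bij T" "\<And>x. x \<in> S \<Longrightarrow> p (f x) = q (f x)" for p q
  proof (rule Bij_eqI[OF that(1,2)])
    fix w assume "w \<in> T"
    then show "p w = q w" using that(3)[of "inv_into S f w"] inv by simp
  qed
  have "\<phi> \<in> iso (perm_group S L) (perm_group T (\<phi> ` L))"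
  proof (rule isoI)
    show "\<phi> \<in> hom (perm_group S L) (perm_group T (\<phi> ` L))"
    proof (rule homI)
      fix k l assume "k \<in> carrier (perm_group S L)" "l \<in> carrier (perm_group S L)"
      then have kl: "k \<in> L" "l \<in> L" by auto
      then have kl': "compose S k l \<in> L"
        using subgroup.m_closed[OF L kl] LB by (simp add: BijGroup_simps)
      show "\<phi> (k \<otimes>\<^bsub>perm_group S L\<^esub> l) = \<phi> k \<otimes>\<^bsub>perm_group T (\<phi> ` L)\<^esub> \<phi> l"
      proof (rule eqI)
        fix x assume x: "x \<in> S"
        then have "l x \<in> S" using LB kl Bij_app by metis
        then show "\<phi> (k \<otimes>\<^bsub>perm_group S L\<^esub> l) (f x)
            = (\<phi> k \<otimes>\<^bsub>perm_group T (\<phi> ` L)\<^esub> \<phi> l) (f x)"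
          using x kl \<phi>B LB fT by (simp add: BijGroup_simps compose_eq app)
      next
        have "k \<otimes>\<^bsub>perm_group S L\<^esub> l = compose S k l" using LB[OF kl(1)] LB[OF kl(2)] by (simp add: BijGroup_simps)
        then show "\<phi> (k \<otimes>\<^bsub>perm_group S L\<^esub> l) \<in> Bij T" using \<phi>B[OF kl'] by simp
        show "\<phi> k \<otimes>\<^bsub>perm_group T (\<phi> ` L)\<^esub> \<phi> l \<in> Bij T"
          using \<phi>B[OF kl(1)] \<phi>B[OF kl(2)] by (simp add: BijGroup_simps compose_Bij)
      qed
    qed simp
    have "inj_on \<phi> L"
    proof (rule inj_onI)
      fix k l assume kl: "k \<in> L" "l \<in> L" "\<phi> k = \<phi> l"
      show "k = l"
      proof (rule Bij_eqI)
        fix x assume x: "x \<in> S"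
        then have "f (k x) = f (l x)" using app kl(3) by metis
        then show "k x = l x"
          using f x kl LB Bij_app by (metis bij_betw_def inj_on_eq_iff)
      qed (use kl LB in auto)
    qed
    then show "bij_betw \<phi> (carrier (perm_group S L)) (carrier (perm_group T (\<phi> ` L)))"
      by (simp add: bij_betw_def)
  qed
  then show ?thesis
    unfolding perm_isomorphic_def \<phi>_def[symmetric] using f app by metis
qed

section \<open>Coset graphs of a finite group as locally-\<open>L\<close> pairs\<close>

section \<open>Coset graphs\<close>

lemma (in group) inv_cancel:
  assumes "g \<in> carrier G" "x \<in> carrier G"
  shows "g \<otimes> (inv g \<otimes> x) = x" "inv g \<otimes> (g \<otimes> x) = x"
  using assms by (simp_all add: m_assoc[symmetric])

text \<open>The vertices are the left cosets of \<open>H\<close>, named by natural numbers through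
  \<open>c\<close> because \<open>graph_restrictive\<close> ranges over graphs on
  \<open>nat\<close>. The neighbours of \<open>H\<close> are the cosets of the \<open>a w\<close>;
  by \<open>a_inj\<close> and \<open>a_act\<close> they correspond bijectively and equivariantly to
  \<open>\<Omega>\<close>. Connectedness comes from \<open>gen\<close>, symmetry from
  \<open>a_invol\<close>, the absence of loops from \<open>a_notin\<close>, and faithfulness on the
  vertices from \<open>core\<close>.\<close>

locale coset_graph = group G for G (structure) +
  fixes H :: "'g set" and a :: "'a \<Rightarrow> 'g" and act :: "'g \<Rightarrow> 'a \<Rightarrow> 'a"
    and \<Omega> :: "'a set" and L :: "('a \<Rightarrow> 'a) set" and c :: "'g \<Rightarrow> nat"
  assumes fin: "finite (carrier G)"
    and H: "subgroup H G"
    and L: "subgroup L (BijGroup \<Omega>)"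
    and act: "act ` H = L"
    and c_eq: "x \<in> carrier G \<Longrightarrow> y \<in> carrier G \<Longrightarrow> c x = c y \<longleftrightarrow> inv x \<otimes> y \<in> H"
    and a_closed: "w \<in> \<Omega> \<Longrightarrow> a w \<in> carrier G"
    and a_invol: "w \<in> \<Omega> \<Longrightarrow> a w \<otimes> a w = \<one>"
    and a_notin: "w \<in> \<Omega> \<Longrightarrow> a w \<notin> H"
    and a_inj: "w \<in> \<Omega> \<Longrightarrow> w' \<in> \<Omega> \<Longrightarrow> c (a w) = c (a w') \<Longrightarrow> w = w'"
    and a_act: "h \<in> H \<Longrightarrow> w \<in> \<Omega> \<Longrightarrow> c (h \<otimes> a w) = c (a (act h w))"
    and gen: "generate G (H \<union> a ` \<Omega>) = carrier G"
    and core: "h \<in> H \<Longrightarrow> (\<And>x. x \<in> carrier G \<Longrightarrow> inv x \<otimes> h \<otimes> x \<in> H) \<Longrightarrow> h = \<one>"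
begin

definition V :: "nat set" where "V = c ` carrier G"

definition \<Gamma> :: "nat pair_pre_digraph" where
  "\<Gamma> = \<lparr>pverts = V, parcs = {(c g, c (g \<otimes> a w)) | g w. g \<in> carrier G \<and> w \<in> \<Omega>}\<rparr>"

text \<open>Left multiplication respects left cosets, so the representative picked by
  \<open>inv_into\<close> does not matter; the restriction to \<open>V\<close> puts the map into
  \<open>Bij V\<close>.\<close>

definition \<Phi> :: "'g \<Rightarrow> nat \<Rightarrow> nat" where
  "\<Phi> g = (\<lambda>v\<in>V. c (g \<otimes> inv_into (carrier G) c v))"

lemma HG: "h \<in> H \<Longrightarrow> h \<in> carrier G"
  using subgroup.subset[OF H] by blast

lemma LB: "l \<in> L \<Longrightarrow> l \<in> Bij \<Omega>"
  using subgroup.subset[OF L] by (auto simp: BijGroup_simps)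

lemma act_closed: "h \<in> H \<Longrightarrow> w \<in> \<Omega> \<Longrightarrow> act h w \<in> \<Omega>"
  using Bij_app[OF LB, of "act h"] act by auto

lemma c_left_iff:
  assumes "g \<in> carrier G" "x \<in> carrier G" "y \<in> carrier G"
  shows "c (g \<otimes> x) = c (g \<otimes> y) \<longleftrightarrow> c x = c y"
proof -
  have "inv (g \<otimes> x) \<otimes> (g \<otimes> y) = inv x \<otimes> y"
    using assms by (simp add: inv_mult_group m_assoc inv_cancel)
  then show ?thesis using assms by (simp add: c_eq)
qed

lemma c_right_H:
  assumes "x \<in> carrier G" "h \<in> H" shows "c (x \<otimes> h) = c x"
proof -
  have "c x = c (x \<otimes> h)"
    using assms HG by (subst c_eq) (simp_all add: inv_cancel)
  then show ?thesis ..
qed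

lemma \<Phi>_app:
  assumes "g \<in> carrier G" "x \<in> carrier G" shows "\<Phi> g (c x) = c (g \<otimes> x)"
proof -
  have "c x \<in> V" using assms by (simp add: V_def)
  then have y: "inv_into (carrier G) c (c x) \<in> carrier G" "c (inv_into (carrier G) c (c x)) = c x"
    unfolding V_def by (rule inv_into_into, rule f_inv_into_f)
  then show ?thesis using assms \<open>c x \<in> V\<close> c_left_iff by (simp add: \<Phi>_def)
qed

lemma \<Phi>_Bij: assumes g: "g \<in> carrier G" shows "\<Phi> g \<in> Bij V"
proof -
  have "inj_on (\<Phi> g) V"
    using g by (auto simp: V_def \<Phi>_app c_left_iff intro!: inj_onI)
  moreover have "\<Phi> g ` V = V"
  proof
    show "\<Phi> g ` V \<subseteq> V" using g by (auto simp: V_def \<Phi>_app)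
    show "V \<subseteq> \<Phi> g ` V"
    proof
      fix v assume "v \<in> V"
      then obtain x where x: "x \<in> carrier G" "v = c x" by (auto simp: V_def)
      then have "\<Phi> g (c (inv g \<otimes> x)) = v"
        using g by (simp add: \<Phi>_app m_assoc[symmetric])
      moreover have "c (inv g \<otimes> x) \<in> V" using x g by (simp add: V_def)
      ultimately show "v \<in> \<Phi> g ` V" by blast
    qed
  qed
  ultimately have "bij_betw (\<Phi> g) V V" by (rule bij_betw_imageI)
  moreover have "\<Phi> g \<in> extensional V" unfolding \<Phi>_def by (rule restrict_extensional)
  ultimately show ?thesis unfolding Bij_def by blast
qed

text \<open>An arc may be given through any representative \<open>k\<close> of the coset of
  \<open>g\<close>. Writing \<open>k\<close> as \<open>g \<otimes> h\<close> with \<open>h\<close>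
  in \<open>H\<close> turns \<open>a w\<close> into \<open>h \<otimes> a w\<close>, which by
  \<open>a_act\<close> has the coset of \<open>a (act h w)\<close>; so the fixed representative
  \<open>g\<close> suffices.\<close>

lemma parcs_iff:
  assumes "g \<in> carrier G" "x \<in> carrier G"
  shows "(c g, c x) \<in> parcs \<Gamma> \<longleftrightarrow> (\<exists>w\<in>\<Omega>. c x = c (g \<otimes> a w))"
proof
  assume "(c g, c x) \<in> parcs \<Gamma>"
  then obtain k w where k: "k \<in> carrier G" "w \<in> \<Omega>" "c g = c k" "c x = c (k \<otimes> a w)"
    by (auto simp: \<Gamma>_def)
  define h where "h = inv g \<otimes> k"
  have h: "h \<in> H" using k assms by (simp add: h_def c_eq)
  have "k \<otimes> a w = g \<otimes> (h \<otimes> a w)"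
    using k assms a_closed by (simp add: h_def m_assoc inv_cancel)
  then have "c x = c (g \<otimes> (h \<otimes> a w))" using k by simp
  also have "\<dots> = c (g \<otimes> a (act h w))"
    using a_act[OF h k(2)] c_left_iff assms h k HG a_closed act_closed by simp
  finally show "\<exists>w\<in>\<Omega>. c x = c (g \<otimes> a w)" using act_closed h k by blast
qed (use assms in \<open>auto simp: \<Gamma>_def\<close>)

lemma neighbourhood_eq:
  assumes "g \<in> carrier G"
  shows "neighbourhood \<Gamma> (c g) = (\<lambda>w. c (g \<otimes> a w)) ` \<Omega>"
proof -
  have "neighbourhood \<Gamma> (c g) \<subseteq> V" using a_closed by (auto simp: neighbourhood_def \<Gamma>_def V_def)
  then have "u \<in> neighbourhood \<Gamma> (c g) \<longleftrightarrow> (\<exists>w\<in>\<Omega>. u = c (g \<otimes> a w))" for u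
    using parcs_iff[OF assms] assms a_closed
    by (auto simp: neighbourhood_def V_def)
  then show ?thesis by auto
qed

lemma \<Phi>_auto: assumes g: "g \<in> carrier G" shows "\<Phi> g \<in> graph_auto \<Gamma>"
proof -
  have "(c x, c y) \<in> parcs \<Gamma> \<longleftrightarrow> (c (g \<otimes> x), c (g \<otimes> y)) \<in> parcs \<Gamma>"
    if "x \<in> carrier G" "y \<in> carrier G" for x y
    using that g a_closed by (simp add: parcs_iff m_assoc c_left_iff)
  then show ?thesis
    using \<Phi>_Bij[OF g] g by (auto simp: graph_auto_def \<Gamma>_def[THEN arg_cong[of _ _ pverts]] V_def \<Phi>_app)
qed

lemma \<Phi>_hom: "group_hom G (GraphAutoGroup \<Gamma>) \<Phi>"
proof -
  have 1: "group (GraphAutoGroup \<Gamma>)"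
    unfolding GraphAutoGroup_def
    by (rule subgroup.subgroup_is_group[OF subgroup_graph_auto group_BijGroup])
  have "\<Phi> (g \<otimes> k) = \<Phi> g \<otimes>\<^bsub>BijGroup V\<^esub> \<Phi> k" if gk: "g \<in> carrier G" "k \<in> carrier G" for g k
  proof (rule Bij_eqI)
    fix v assume v: "v \<in> V"
    then obtain x where x: "x \<in> carrier G" "v = c x" by (auto simp: V_def)
    then show "\<Phi> (g \<otimes> k) v = (\<Phi> g \<otimes>\<^bsub>BijGroup V\<^esub> \<Phi> k) v"
      using gk v by (simp add: BijGroup_simps \<Phi>_Bij compose_eq \<Phi>_app m_assoc)
  qed (use gk \<Phi>_Bij in \<open>simp_all add: BijGroup_simps compose_Bij\<close>)
  then have "\<Phi> \<in> hom G (GraphAutoGroup \<Gamma>)"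
    using \<Phi>_auto by (intro homI) (simp_all add: GraphAutoGroup_def \<Gamma>_def)
  then show ?thesis by (intro group_hom.intro 1 group_hom_axioms.intro is_group)
qed

lemma pverts_\<Gamma>: "pverts \<Gamma> = V" by (simp add: \<Gamma>_def)

text \<open>An element \<open>k\<close> fixes the coset of \<open>g\<close> exactly when
  \<open>inv g \<otimes> k \<otimes> g\<close> lies in \<open>H\<close>.\<close>

lemma stabilizer_eq:
  assumes g: "g \<in> carrier G"
  shows "point_stabilizer V (\<Phi> ` carrier G) (c g) = (\<lambda>h. \<Phi> (g \<otimes> h \<otimes> inv g)) ` H"
proof (intro equalityI subsetI)
  fix p assume "p \<in> point_stabilizer V (\<Phi> ` carrier G) (c g)"
  then obtain k where k: "k \<in> carrier G" "p = \<Phi> k" "\<Phi> k (c g) = c g"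
    by (auto simp: stabilizer_def)
  then have "c g = c (k \<otimes> g)" using g by (simp add: \<Phi>_app)
  then have "inv g \<otimes> (k \<otimes> g) \<in> H" using c_eq g k by simp
  then have "\<Phi> (g \<otimes> (inv g \<otimes> (k \<otimes> g)) \<otimes> inv g) \<in> (\<lambda>h. \<Phi> (g \<otimes> h \<otimes> inv g)) ` H" by blast
  moreover have "g \<otimes> (inv g \<otimes> (k \<otimes> g)) \<otimes> inv g = k"
    using g k by (simp add: m_assoc inv_cancel)
  ultimately show "p \<in> (\<lambda>h. \<Phi> (g \<otimes> h \<otimes> inv g)) ` H" using k(2) by simp
next
  fix p assume "p \<in> (\<lambda>h. \<Phi> (g \<otimes> h \<otimes> inv g)) ` H"
  then obtain h where h: "h \<in> H" "p = \<Phi> (g \<otimes> h \<otimes> inv g)" by blast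
  then have "p (c g) = c g" using g HG by (simp add: \<Phi>_app m_assoc c_right_H)
  then show "p \<in> point_stabilizer V (\<Phi> ` carrier G) (c g)"
    using h g HG by (auto simp: stabilizer_def)
qed

text \<open>If the conjugates of \<open>h\<close> and \<open>k\<close> by \<open>g\<close> act
  alike, evaluation at the cosets of all \<open>g \<otimes> x\<close> puts
  \<open>inv h \<otimes> k\<close> into every conjugate of \<open>H\<close>, and \<open>core\<close>
  identifies \<open>h\<close> with \<open>k\<close>.\<close>

lemma card_stabilizer:
  assumes "v \<in> V"
  shows "card (point_stabilizer V (\<Phi> ` carrier G) v) = card H"
proof -
  obtain g where g: "g \<in> carrier G" "v = c g" using assms by (auto simp: V_def)
  have "inj_on (\<lambda>h. \<Phi> (g \<otimes> h \<otimes> inv g)) H"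
  proof (rule inj_onI)
    fix h k assume hk: "h \<in> H" "k \<in> H" "\<Phi> (g \<otimes> h \<otimes> inv g) = \<Phi> (g \<otimes> k \<otimes> inv g)"
    have "inv h \<otimes> k = \<one>"
    proof (rule core)
      show "inv h \<otimes> k \<in> H"
        using H hk by (simp add: subgroup.m_closed subgroup.m_inv_closed)
      fix x assume x: "x \<in> carrier G"
      have "\<Phi> (g \<otimes> h \<otimes> inv g) (c (g \<otimes> x)) = \<Phi> (g \<otimes> k \<otimes> inv g) (c (g \<otimes> x))" using hk by simp
      moreover have "g \<otimes> y \<otimes> inv g \<otimes> (g \<otimes> x) = g \<otimes> (y \<otimes> x)" if "y \<in> H" for y
        using that x g HG by (simp add: m_assoc inv_cancel)
      ultimately have "c (g \<otimes> (h \<otimes> x)) = c (g \<otimes> (k \<otimes> x))"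
        using hk(1,2) x g HG by (simp add: \<Phi>_app)
      then have "c (h \<otimes> x) = c (k \<otimes> x)"
        using hk x g HG by (simp add: c_left_iff)
      then show "inv x \<otimes> (inv h \<otimes> k) \<otimes> x \<in> H"
        using hk x HG by (simp add: c_eq inv_mult_group m_assoc)
    qed
    then show "h = k" using hk HG by (metis inv_equality inv_inv inv_closed)
  qed
  then show ?thesis using g by (simp add: stabilizer_eq card_image)
qed

text \<open>Loops are excluded by \<open>a_notin\<close>. An arc is reversed by multiplying with the
  same involution \<open>a w\<close> once more.\<close>

lemma pair_graph_\<Gamma>: "pair_graph \<Gamma>"
proof
  fix e assume e: "e \<in> parcs \<Gamma>"
  then obtain g w where gw: "e = (c g, c (g \<otimes> a w))" "g \<in> carrier G" "w \<in> \<Omega>"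
    by (auto simp: \<Gamma>_def)
  show "fst e \<in> pverts \<Gamma>" "snd e \<in> pverts \<Gamma>"
    using gw a_closed by (auto simp: pverts_\<Gamma> V_def)
  show "fst e \<noteq> snd e"
    using gw a_closed a_notin by (simp add: c_eq m_assoc[symmetric])
next
  show V: "finite (pverts \<Gamma>)" using fin by (simp add: pverts_\<Gamma> V_def)
  have "parcs \<Gamma> \<subseteq> V \<times> V" using a_closed by (auto simp: \<Gamma>_def V_def)
  then show "finite (parcs \<Gamma>)"
    using V by (auto simp: pverts_\<Gamma> intro: finite_subset)
  show "symmetric \<Gamma>"
    unfolding symmetric_def with_proj_simps
  proof (rule symI)
    fix u v assume "(u, v) \<in> parcs \<Gamma>"
    then obtain g w where gw: "u = c g" "v = c (g \<otimes> a w)" "g \<in> carrier G" "w \<in> \<Omega>"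
      by (auto simp: \<Gamma>_def)
    then have "u = c (g \<otimes> a w \<otimes> a w)" using a_closed a_invol by (simp add: m_assoc)
    then show "(v, u) \<in> parcs \<Gamma>" using gw a_closed unfolding \<Gamma>_def by auto
  qed
qed

text \<open>A word in the generators is read as a walk: factors from \<open>H\<close> stay at the
  same coset, factors \<open>a w\<close> follow an arc.\<close>

lemma connected_\<Gamma>: "Digraph_Component.connected (with_proj \<Gamma>)"
proof -
  interpret \<Gamma>: pair_graph \<Gamma> by (rule pair_graph_\<Gamma>)
  \<comment> \<open>The starting point \<open>g\<close> is left arbitrary, since the second factor
    of a product continues from \<open>g \<otimes> x\<close>.\<close>
  have reach: "reachable (with_proj \<Gamma>) (c g) (c (g \<otimes> x))"
    if "x \<in> generate G (H \<union> a ` \<Omega>)" "g \<in> carrier G" for x g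
    using that
  proof (induction x arbitrary: g rule: generate.induct)
    case one
    then show ?case by (simp add: pverts_\<Gamma> V_def)
  next
    case (incl x)
    show ?case
    proof (cases "x \<in> H")
      case True
      then show ?thesis using incl by (simp add: c_right_H pverts_\<Gamma> V_def)
    next
      case False
      then have "(c g, c (g \<otimes> x)) \<in> parcs \<Gamma>" using incl by (auto simp: \<Gamma>_def)
      then show ?thesis by (rule \<Gamma>.reachable_adjI)
    qed
  next
    case (inv x)
    show ?case
    proof (cases "x \<in> H")
      case True
      then show ?thesis
        using inv H by (simp add: c_right_H pverts_\<Gamma> V_def subgroup.m_inv_closed)
    next
      case False
      then obtain w where w: "w \<in> \<Omega>" "x = a w" using inv by auto
      then have "inv x = x" using a_invol a_closed by (simp add: inv_equality)
      then have "(c g, c (g \<otimes> inv x)) \<in> parcs \<Gamma>" using inv w by (auto simp: \<Gamma>_def)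
      then show ?thesis by (rule \<Gamma>.reachable_adjI)
    qed
  next
    case (eng x y)
    then have xy: "x \<in> carrier G" "y \<in> carrier G" using gen by auto
    have "reachable (with_proj \<Gamma>) (c g) (c (g \<otimes> x))" using eng by blast
    also have "reachable (with_proj \<Gamma>) (c (g \<otimes> x)) (c (g \<otimes> x \<otimes> y))" using eng xy by blast
    finally show ?case using xy eng by (simp add: m_assoc)
  qed
  have "strongly_connected (with_proj \<Gamma>)"
  proof (rule strongly_connectedI)
    show "verts (with_proj \<Gamma>) \<noteq> {}" by (auto simp: pverts_\<Gamma> V_def)
    fix u v assume "u \<in> verts (with_proj \<Gamma>)" "v \<in> verts (with_proj \<Gamma>)"
    then obtain g k where "g \<in> carrier G" "k \<in> carrier G" "u = c g" "v = c k"
      by (auto simp: pverts_\<Gamma> V_def)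
    then show "reachable (with_proj \<Gamma>) u v"
      using reach[of "inv g \<otimes> k" g] gen by (simp add: inv_cancel)
  qed
  \<comment> \<open>The symmetrisation inside \<open>connected\<close> does not affect reachability,
    as every arc is already reversible.\<close>
  then show ?thesis
    unfolding Digraph_Component.connected_def strongly_connected_def
    using \<Gamma>.reachable_mk_symmetric_eq \<Gamma>.sym_arcs by simp
qed

text \<open>The element \<open>g \<otimes> h \<otimes> inv g\<close> of the stabiliser sends the
  neighbour \<open>f w\<close> to the coset of \<open>g \<otimes> (h \<otimes> a w)\<close>, which
  is \<open>f (act h w)\<close>. So the local action is \<open>L\<close> conjugated by
  \<open>f\<close>.\<close>

lemma local_action_eq:
  assumes g: "g \<in> carrier G"
  defines "f \<equiv> \<lambda>w. c (g \<otimes> a w)"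
  shows "local_action \<Gamma> (\<Phi> ` carrier G) (c g)
    = (\<lambda>l. \<lambda>u\<in>f ` \<Omega>. f (l (inv_into \<Omega> f u))) ` L"
proof -
  have inj: "inj_on f \<Omega>"
    using g a_closed a_inj by (auto simp: f_def c_left_iff intro: inj_onI)
  have "restrict (\<Phi> (g \<otimes> h \<otimes> inv g)) (f ` \<Omega>) = (\<lambda>u\<in>f ` \<Omega>. f (act h (inv_into \<Omega> f u)))"
    if h: "h \<in> H" for h
  proof (rule restrict_ext)
    fix u assume "u \<in> f ` \<Omega>"
    then obtain w where w: "w \<in> \<Omega>" "u = f w" by blast
    have "g \<otimes> h \<otimes> inv g \<otimes> (g \<otimes> a w) = g \<otimes> (h \<otimes> a w)"
      using g h w a_closed HG by (simp add: m_assoc inv_cancel)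
    then have "\<Phi> (g \<otimes> h \<otimes> inv g) u = c (g \<otimes> (h \<otimes> a w))"
      using g h w a_closed HG by (simp add: f_def \<Phi>_app)
    also have "\<dots> = f (act h w)"
      using g h w a_closed HG a_act act_closed by (simp add: f_def c_left_iff)
    finally show "\<Phi> (g \<otimes> h \<otimes> inv g) u = f (act h (inv_into \<Omega> f u))"
      using inj w by simp
  qed
  then have "(\<lambda>h. restrict (\<Phi> (g \<otimes> h \<otimes> inv g)) (f ` \<Omega>)) ` H
      = (\<lambda>h. \<lambda>u\<in>f ` \<Omega>. f (act h (inv_into \<Omega> f u))) ` H"
    by (rule image_cong[OF refl])
  also have "\<dots> = (\<lambda>l. \<lambda>u\<in>f ` \<Omega>. f (l (inv_into \<Omega> f u))) ` act ` H"
    unfolding image_image ..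
  finally show ?thesis
    unfolding local_action_def pverts_\<Gamma> stabilizer_eq[OF g] neighbourhood_eq[OF g]
      f_def[symmetric] image_image act .
qed

lemma \<Phi>_subgroup: "subgroup (\<Phi> ` carrier G) (GraphAutoGroup \<Gamma>)"
  using group_hom.img_is_subgroup[OF \<Phi>_hom] .

lemma \<Phi>_subgroup_Bij: "subgroup (\<Phi> ` carrier G) (BijGroup V)"
  using group.incl_subgroup[OF group_BijGroup subgroup_graph_auto \<Phi>_subgroup[unfolded GraphAutoGroup_def]]
  unfolding pverts_\<Gamma> .

lemma \<Phi>_transitive: "perm_transitive V (\<Phi> ` carrier G)"
proof -
  have "\<exists>p\<in>\<Phi> ` carrier G. p u = v" if uv: "u \<in> V" "v \<in> V" for u v
  proof -
    obtain g k where gk: "g \<in> carrier G" "k \<in> carrier G" "u = c g" "v = c k"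
      using uv unfolding V_def by blast
    then have "\<Phi> (k \<otimes> inv g) u = v" by (simp add: \<Phi>_app m_assoc)
    moreover have "k \<otimes> inv g \<in> carrier G" using gk by simp
    ultimately show ?thesis by blast
  qed
  then show ?thesis unfolding perm_transitive_iff[OF \<Phi>_subgroup_Bij] by blast
qed

lemma locally_pair_\<Gamma>: "locally_pair \<Omega> L \<Gamma> (\<Phi> ` carrier G)"
proof -
  have "perm_isomorphic \<Omega> L (neighbourhood \<Gamma> v) (local_action \<Gamma> (\<Phi> ` carrier G) v)"
    if v: "v \<in> V" for v
  proof -
    obtain g where g: "g \<in> carrier G" "v = c g" using v unfolding V_def by blast
    have "bij_betw (\<lambda>w. c (g \<otimes> a w)) \<Omega> ((\<lambda>w. c (g \<otimes> a w)) ` \<Omega>)"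
      using g a_closed a_inj by (auto simp: c_left_iff bij_betw_def intro: inj_onI)
    from perm_isomorphic_conjugate[OF L this] show ?thesis
      unfolding g(2) local_action_eq[OF g(1)] neighbourhood_eq[OF g(1)] .
  qed
  then show ?thesis
    unfolding locally_pair_def pverts_\<Gamma>
    using pair_graph_\<Gamma> connected_\<Gamma> \<Phi>_subgroup \<Phi>_transitive by blast
qed

end

section \<open>Realising partial automorphisms of a finite group inside a finite permutation
  group\<close>

section \<open>Finite completions\<close>

text \<open>The sets \<open>S x\<close> below are the left cosets; being finite in number, they can
  be numbered injectively.\<close>

lemma (in group) exists_coset_labelling:
  assumes "finite (carrier G)" "subgroup H G"
  shows "\<exists>c::'a \<Rightarrow> nat. \<forall>x\<in>carrier G. \<forall>y\<in>carrier G. c x = c y \<longleftrightarrow> inv x \<otimes> y \<in> H"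
proof -
  define S where "S x = {y \<in> carrier G. inv x \<otimes> y \<in> H}" for x
  have S: "S x = S y \<longleftrightarrow> inv x \<otimes> y \<in> H" if xy: "x \<in> carrier G" "y \<in> carrier G" for x y
  proof
    assume "S x = S y"
    moreover have "y \<in> S y" using xy subgroup.one_closed[OF assms(2)] by (simp add: S_def)
    ultimately have "y \<in> S x" by blast
    then show "inv x \<otimes> y \<in> H" by (simp add: S_def)
  next
    assume h: "inv x \<otimes> y \<in> H"
    have h': "inv y \<otimes> x \<in> H"
      using subgroup.m_inv_closed[OF assms(2) h] xy by (simp add: inv_mult_group)
    have "inv x \<otimes> z \<in> H \<longleftrightarrow> inv y \<otimes> z \<in> H" if z: "z \<in> carrier G" for z
    proof
      assume "inv x \<otimes> z \<in> H"
      from subgroup.m_closed[OF assms(2) h' this] show "inv y \<otimes> z \<in> H"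
        using xy z by (simp add: m_assoc inv_cancel)
    next
      assume "inv y \<otimes> z \<in> H"
      from subgroup.m_closed[OF assms(2) h this] show "inv x \<otimes> z \<in> H"
        using xy z by (simp add: m_assoc inv_cancel)
    qed
    then show "S x = S y" by (auto simp: S_def)
  qed
  have "finite (S ` carrier G)" using assms by simp
  then obtain e :: "'a set \<Rightarrow> nat" where e: "inj_on e (S ` carrier G)"
    using finite_imp_inj_to_nat_seg[of "S ` carrier G"] by auto
  have "\<forall>x\<in>carrier G. \<forall>y\<in>carrier G. (e \<circ> S) x = (e \<circ> S) y \<longleftrightarrow> inv x \<otimes> y \<in> H"
  proof (intro ballI)
    fix x y assume xy: "x \<in> carrier G" "y \<in> carrier G"
    then have "e (S x) = e (S y) \<longleftrightarrow> S x = S y" by (intro inj_on_eq_iff[OF e] imageI)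
    then show "(e \<circ> S) x = (e \<circ> S) y \<longleftrightarrow> inv x \<otimes> y \<in> H"
      unfolding S[OF xy] by (simp only: o_apply)
  qed
  then show ?thesis by blast
qed

text \<open>Every \<open>x\<close> factors as an element of \<open>B\<close> times the chosen
  representative of its right coset, and \<open>r x\<close> is the first factor. Left multiplication
  by \<open>B\<close> keeps the coset and hence the representative, which gives
  equivariance.\<close>

lemma (in group) exists_equivariant_retraction:
  assumes B: "subgroup B G"
  shows "\<exists>r. (\<forall>x\<in>carrier G. r x \<in> B) \<and> (\<forall>b\<in>B. \<forall>x\<in>carrier G. r (b \<otimes> x) = b \<otimes> r x) \<and> r \<one> = \<one>"
proof -
  have BG: "b \<in> carrier G" if "b \<in> B" for b using subgroup.subset[OF B] that by blast
  \<comment> \<open>Representing \<open>B\<close> itself by \<open>\<one>\<close> is what yields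
    \<open>r \<one> = \<one>\<close>.\<close>
  define rep where "rep C = (if \<one> \<in> C then \<one> else SOME y. y \<in> C)" for C
  have rep: "rep (B #> x) \<in> B #> x" if "x \<in> carrier G" for x
    using rcos_self[OF that B] unfolding rep_def by (auto intro: someI)
  define r where "r x = x \<otimes> inv (rep (B #> x))" for x
  have "r x \<in> B" if x: "x \<in> carrier G" for x
  proof -
    obtain b where b: "b \<in> B" "rep (B #> x) = b \<otimes> x" using rep[OF x] by (auto simp: r_coset_def)
    then have "r x = inv b" using x BG by (simp add: r_def inv_mult_group inv_cancel)
    then show ?thesis using b B by (simp add: subgroup.m_inv_closed)
  qed
  moreover have "r (b \<otimes> x) = b \<otimes> r x" if bx: "b \<in> B" "x \<in> carrier G" for b x
  proof -
    have "B #> (b \<otimes> x) = B #> x"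
      using coset_mult_assoc[of B b x] coset_join2[OF _ B, of b] bx BG subgroup.subset[OF B] by simp
    moreover have "rep (B #> x) \<in> carrier G"
      using rep[OF bx(2)] r_coset_subset_G[OF subgroup.subset[OF B] bx(2)] by blast
    ultimately show ?thesis using bx BG by (simp add: r_def m_assoc)
  qed
  moreover have "r \<one> = \<one>"
    using subgroup.one_closed[OF B] coset_mult_one[OF subgroup.subset[OF B]]
    by (simp add: r_def rep_def)
  ultimately show ?thesis by blast
qed

text \<open>In contrast to \<open>BijGroup\<close>, the elements are total functions that fix
  everything outside \<open>X\<close>, so products are plain compositions without
  restriction.\<close>

definition sym_on :: "'x set \<Rightarrow> ('x \<Rightarrow> 'x) monoid" where
  "sym_on X = \<lparr>carrier = {p. p permutes X}, monoid.mult = (\<circ>), one = id\<rparr>"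

lemma sym_on_simps [simp]:
  "carrier (sym_on X) = {p. p permutes X}" "p \<otimes>\<^bsub>sym_on X\<^esub> q = p \<circ> q" "\<one>\<^bsub>sym_on X\<^esub> = id"
  by (simp_all add: sym_on_def)

lemma group_sym_on: "group (sym_on X)"
proof (rule groupI)
  fix p assume "p \<in> carrier (sym_on X)"
  then have "inv_into UNIV p permutes X" "inv_into UNIV p \<circ> p = id"
    by (simp_all add: permutes_inv permutes_inv_o)
  then show "\<exists>q\<in>carrier (sym_on X). q \<otimes>\<^bsub>sym_on X\<^esub> p = \<one>\<^bsub>sym_on X\<^esub>" by auto
qed (auto simp: permutes_compose permutes_id o_assoc)

lemma permutes_byWitness:
  assumes "\<And>x. x \<in> X \<Longrightarrow> p x \<in> X" "\<And>x. x \<in> X \<Longrightarrow> q x \<in> X" "\<And>x. x \<notin> X \<Longrightarrow> p x = x"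
    and "\<And>x. x \<in> X \<Longrightarrow> q (p x) = x" "\<And>x. x \<in> X \<Longrightarrow> p (q x) = x"
  shows "p permutes X"
  using assms by (intro bij_imp_permutes bij_betw_byWitness[where f' = q]) auto

text \<open>Each \<open>\<sigma> j\<close> is an automorphism of order at most two, of the subgroup
  \<open>B j\<close> only. The aim is a finite group containing a copy of \<open>D\<close> in which
  \<open>\<sigma> j\<close> becomes conjugation by an involution.\<close>

locale partial_automorphisms = group D for D (structure) +
  fixes J :: "'j set" and B :: "'j \<Rightarrow> 'd set" and \<sigma> :: "'j \<Rightarrow> 'd \<Rightarrow> 'd"
  assumes fin_D: "finite (carrier D)" and fin_J: "finite J"
    and B: "j \<in> J \<Longrightarrow> subgroup (B j) D"
    and \<sigma>_closed: "j \<in> J \<Longrightarrow> x \<in> B j \<Longrightarrow> \<sigma> j x \<in> B j"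
    and \<sigma>_mult: "j \<in> J \<Longrightarrow> x \<in> B j \<Longrightarrow> y \<in> B j \<Longrightarrow> \<sigma> j (x \<otimes> y) = \<sigma> j x \<otimes> \<sigma> j y"
    and \<sigma>_invol: "j \<in> J \<Longrightarrow> x \<in> B j \<Longrightarrow> \<sigma> j (\<sigma> j x) = x"
begin

text \<open>One copy of \<open>D\<close> for each subset of \<open>J\<close>; the subset keeps for
  every \<open>j\<close> a parity that only \<open>twist j\<close> can change.\<close>

definition X :: "('d \<times> 'j set) set" where "X = carrier D \<times> Pow J"

definition r :: "'j \<Rightarrow> 'd \<Rightarrow> 'd" where
  "r j = (SOME r. (\<forall>x\<in>carrier D. r x \<in> B j) \<and>
    (\<forall>b\<in>B j. \<forall>x\<in>carrier D. r (b \<otimes> x) = b \<otimes> r x) \<and> r \<one> = \<one>)"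

definition transl :: "'d \<Rightarrow> 'd \<times> 'j set \<Rightarrow> 'd \<times> 'j set" where
  "transl d = (\<lambda>(x, m). if (x, m) \<in> X then (d \<otimes> x, m) else (x, m))"

text \<open>
  A copy of \<open>\<sigma> j\<close> on every right coset of \<open>B j\<close>: by equivariance of \<open>r j\<close>, each \<open>x\<close> is the product of
  \<open>r j x \<in> B j\<close> and the coset representative \<open>inv (r j x) \<otimes> x\<close>. Toggling \<open>j\<close> in the second component
  on the coset \<open>B j\<close> alone ensures that \<open>twist j\<close> conjugates no translation by an element outside
  \<open>B j\<close> to a translation, and that different twists lie in different double cosets.
\<close>

definition twist :: "'j \<Rightarrow> 'd \<times> 'j set \<Rightarrow> 'd \<times> 'j set" where
  "twist j = (\<lambda>(x, m). if (x, m) \<in> X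
     then (\<sigma> j (r j x) \<otimes> (inv (r j x) \<otimes> x), if x \<in> B j then sym_diff m {j} else m)
     else (x, m))"

definition K :: "('d \<times> 'j set \<Rightarrow> 'd \<times> 'j set) monoid" where
  "K = subgroup_generated (sym_on X) (transl ` carrier D \<union> twist ` J)"

lemma BD: "j \<in> J \<Longrightarrow> b \<in> B j \<Longrightarrow> b \<in> carrier D"
  using subgroup.subset[OF B] by blast

lemma r_closed: "j \<in> J \<Longrightarrow> x \<in> carrier D \<Longrightarrow> r j x \<in> B j"
  and r_mult: "j \<in> J \<Longrightarrow> b \<in> B j \<Longrightarrow> x \<in> carrier D \<Longrightarrow> r j (b \<otimes> x) = b \<otimes> r j x"
  and r_one: "j \<in> J \<Longrightarrow> r j \<one> = \<one>"
  using someI_ex[OF exists_equivariant_retraction[OF B], of j] unfolding r_def[symmetric] by blast+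

lemma B_mult_iff:
  assumes "j \<in> J" "b \<in> B j" "x \<in> carrier D" shows "b \<otimes> x \<in> B j \<longleftrightarrow> x \<in> B j"
proof
  assume "b \<otimes> x \<in> B j"
  with assms have "inv b \<otimes> (b \<otimes> x) \<in> B j"
    using subgroup.m_closed[OF B] subgroup.m_inv_closed[OF B] by blast
  then show "x \<in> B j" using assms BD by (simp add: inv_cancel)
qed (use assms subgroup.m_closed[OF B] in blast)

lemma \<sigma>_one: "j \<in> J \<Longrightarrow> \<sigma> j \<one> = \<one>"
proof -
  assume j: "j \<in> J"
  have 1: "\<one> \<in> B j" by (rule subgroup.one_closed[OF B[OF j]])
  then have "\<sigma> j \<one> = \<sigma> j \<one> \<otimes> \<sigma> j \<one>" using \<sigma>_mult[OF j 1 1] by simp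
  then show "\<sigma> j \<one> = \<one>" using BD[OF j \<sigma>_closed[OF j 1]] by (metis r_cancel_one)
qed

lemma transl_permutes: assumes "d \<in> carrier D" shows "transl d permutes X"
  by (rule permutes_byWitness[where q = "transl (inv d)"]) (use assms in \<open>auto simp: transl_def X_def inv_cancel split: if_splits\<close>)

lemma transl_mult: "d \<in> carrier D \<Longrightarrow> e \<in> carrier D \<Longrightarrow> transl (d \<otimes> e) = transl d \<circ> transl e"
  by (auto simp: transl_def X_def m_assoc fun_eq_iff)

lemma transl_one: "transl \<one> = id"
  by (auto simp: transl_def X_def fun_eq_iff)

lemma transl_inj: "inj_on transl (carrier D)"
proof (rule inj_onI)
  fix d e assume de: "d \<in> carrier D" "e \<in> carrier D" "transl d = transl e"
  from fun_cong[OF de(3), of "(\<one>, {})"] show "d = e" using de by (simp add: transl_def X_def)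
qed

lemma twist_X: assumes "j \<in> J" "p \<in> X" shows "twist j p \<in> X"
  using assms BD r_closed \<sigma>_closed by (auto simp: twist_def X_def)

text \<open>With \<open>s\<close> for \<open>r j x\<close>, the map replaces the factor
  \<open>s\<close> of \<open>x\<close> by \<open>\<sigma> j s\<close> and stays in the same right
  coset of \<open>B j\<close>. A second application restores \<open>s\<close> by
  \<open>\<sigma>_invol\<close>, and the toggle cancels itself.\<close>

lemma twist_twist: assumes j: "j \<in> J" shows "twist j (twist j p) = p"
proof (cases "p \<in> X")
  case True
  obtain x m where p: "p = (x, m)" by (cases p)
  have x: "x \<in> carrier D" and m: "m \<subseteq> J" using True p by (auto simp: X_def)
  define s where "s = r j x"
  define y where "y = \<sigma> j s \<otimes> (inv s \<otimes> x)"
  have s: "s \<in> B j" "\<sigma> j s \<in> B j" using r_closed \<sigma>_closed j x by (auto simp: s_def)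
  have si: "inv s \<in> B j" using s B[OF j] by (simp add: subgroup.m_inv_closed)
  have sD: "s \<in> carrier D" "\<sigma> j s \<in> carrier D" using s BD[OF j] by auto
  have y: "y \<in> carrier D" using sD x by (simp add: y_def)
  have "r j y = \<sigma> j s \<otimes> (inv s \<otimes> s)"
    unfolding y_def using r_mult[OF j s(2)] r_mult[OF j si] sD x by (simp add: s_def)
  then have "r j y = \<sigma> j s" using sD by simp
  moreover have "y \<in> B j \<longleftrightarrow> x \<in> B j"
    unfolding y_def using B_mult_iff[OF j s(2)] B_mult_iff[OF j si] sD x by simp
  moreover have "(y, m') \<in> X \<longleftrightarrow> m' \<subseteq> J" for m' using y by (simp add: X_def)
  moreover have "twist j p = (y, if x \<in> B j then sym_diff m {j} else m)"
    using True by (simp add: p twist_def y_def s_def)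
  moreover have "\<sigma> j (\<sigma> j s) \<otimes> (inv (\<sigma> j s) \<otimes> y) = x"
    unfolding y_def using \<sigma>_invol[OF j s(1)] sD x by (simp add: inv_cancel)
  moreover have "sym_diff (sym_diff m {j}) {j} = m" "sym_diff m {j} \<subseteq> J" using m j by auto
  ultimately show ?thesis using m by (simp add: p twist_def)
qed (auto simp: twist_def split: prod.splits)

lemma twist_permutes: assumes "j \<in> J" shows "twist j permutes X"
  by (rule permutes_byWitness[where q = "twist j"])
    (use assms twist_X twist_twist in \<open>auto simp: twist_def\<close>)

text \<open>Left multiplication by \<open>d\<close> in \<open>B j\<close> changes the factor
  \<open>r j x\<close> to \<open>d \<otimes> r j x\<close> but keeps the coset representative and
  membership in \<open>B j\<close>. Multiplicativity of \<open>\<sigma> j\<close> then moves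
  \<open>d\<close> past the twist as \<open>\<sigma> j d\<close>.\<close>

lemma twist_transl: assumes j: "j \<in> J" and d: "d \<in> B j" shows "twist j \<circ> transl d \<circ> twist j = transl (\<sigma> j d)"
proof -
  have "twist j (transl d p) = transl (\<sigma> j d) (twist j p)" for p
  proof (cases "p \<in> X")
    case True
    obtain x m where p: "p = (x, m)" by (cases p)
    have x: "x \<in> carrier D" and m: "m \<subseteq> J" using True p by (auto simp: X_def)
    have rx: "r j x \<in> B j" "r j x \<in> carrier D" "\<sigma> j (r j x) \<in> carrier D"
      using r_closed \<sigma>_closed BD j x by auto
    have dD: "d \<in> carrier D" "\<sigma> j d \<in> carrier D" using BD[OF j] \<sigma>_closed[OF j] d by auto
    have "twist j p \<in> X" by (rule twist_X[OF j True])
    then show ?thesis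
      using True m j d dD x rx
      by (auto simp: p twist_def transl_def X_def r_mult B_mult_iff \<sigma>_mult inv_mult_group m_assoc inv_cancel)
  qed (auto simp: twist_def transl_def split: prod.splits)
  then show ?thesis using twist_twist[OF j] by (auto simp: fun_eq_iff)
qed

lemma twist_base: "j \<in> J \<Longrightarrow> twist j (\<one>, {}) = (\<one>, {j})"
  using subgroup.one_closed[OF B] by (simp add: twist_def X_def r_one \<sigma>_one)

lemma twist_not_transl: assumes "j \<in> J" shows "twist j \<noteq> transl d"
proof
  assume "twist j = transl d"
  from fun_cong[OF this, of "(\<one>, {})"] show False
    using twist_base[OF assms] by (simp add: transl_def X_def)
qed

text \<open>The point \<open>(\<one>, {})\<close> is tracked: \<open>twist j\<close> turns its
  second component into \<open>{j}\<close>, the translation moves its first component to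
  \<open>d\<close>, and \<open>twist i\<close> can empty the second component again only if
  \<open>d\<close> lies in \<open>B i\<close> and \<open>i\<close> equals \<open>j\<close>.\<close>

lemma twist_transl_twist:
  assumes "i \<in> J" "j \<in> J" "d \<in> carrier D" "twist i \<circ> transl d \<circ> twist j = transl e"
  shows "i = j" "d \<in> B j"
proof -
  have "snd (twist i (d, {j})) = {}"
    using fun_cong[OF assms(4), of "(\<one>, {})"] twist_base[OF assms(2)] assms(2,3)
    by (simp add: transl_def X_def)
  moreover have "snd (twist i (d, {j})) = (if d \<in> B i then sym_diff {j} {i} else {j})"
    using assms(2,3) by (simp add: twist_def X_def)
  ultimately have e: "(if d \<in> B i then sym_diff {j} {i} else {j}) = {}" by metis
  have d: "d \<in> B i" using e by (cases "d \<in> B i") (simp_all only: if_False insert_not_empty)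
  with e have "sym_diff {j} {i} = {}" by (simp only: if_True)
  then have "j \<in> {i}" by blast
  then have "i = j \<and> d \<in> B j" using d by blast
  then show "i = j" "d \<in> B j" by auto
qed

lemma group_K: "group K"
  unfolding K_def by (rule group.group_subgroup_generated[OF group_sym_on])

lemma K_simps [simp]: "p \<otimes>\<^bsub>K\<^esub> q = p \<circ> q" "\<one>\<^bsub>K\<^esub> = id"
  by (simp_all add: K_def)

lemma carrier_K: "carrier K = generate (sym_on X) (transl ` carrier D \<union> twist ` J)"
proof -
  have "transl ` carrier D \<union> twist ` J \<subseteq> carrier (sym_on X)"
    using transl_permutes twist_permutes by auto
  then show ?thesis by (simp add: K_def carrier_subgroup_generated Int_absorb1 del: sym_on_simps)
qed

lemma generate_K: assumes "S \<subseteq> carrier K" shows "generate K S = generate (sym_on X) S"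
proof -
  have "subgroup (carrier K) (sym_on X)"
    unfolding K_def by (rule group.subgroup_subgroup_generated[OF group_sym_on])
  from group.generate_consistent[OF group_sym_on assms this] show ?thesis
    by (simp add: K_def subgroup_generated_def)
qed

lemma finite_K: "finite (carrier K)"
proof -
  have "carrier K \<subseteq> {p. p permutes X}"
    unfolding K_def using group.subgroup_subgroup_generated[OF group_sym_on, THEN subgroup.subset]
    by simp
  moreover have "finite X" using fin_D fin_J by (simp add: X_def)
  ultimately show ?thesis using finite_permutations finite_subset by blast
qed

lemma transl_K: "d \<in> carrier D \<Longrightarrow> transl d \<in> carrier K"
  and twist_K: "j \<in> J \<Longrightarrow> twist j \<in> carrier K"
  unfolding carrier_K by (auto intro: generate.incl)

lemma transl_hom: "group_hom D K transl"
  by (intro group_hom.intro group_hom_axioms.intro homI is_group group_K)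
    (simp_all add: transl_K transl_mult)

end

text \<open>Here \<open>J\<close> is a transversal of the orbits of \<open>D\<close> on
  \<open>\<Omega>\<close>, and \<open>\<sigma> j\<close> lives on the stabiliser of
  \<open>j\<close>. The condition \<open>no_core\<close> will make the action on the coset graph
  faithful.\<close>

locale stabilizer_automorphisms =
  partial_automorphisms D J "stabilizer D \<theta>" \<sigma> + action: group_action D \<Omega> \<theta>
  for D (structure) and J :: "'a set" and \<theta> :: "'d \<Rightarrow> 'a \<Rightarrow> 'a" and \<sigma> and \<Omega> +
  assumes J_\<Omega>: "J \<subseteq> \<Omega>"
    and ex_rep: "w \<in> \<Omega> \<Longrightarrow> \<exists>j\<in>J. \<exists>d\<in>carrier D. \<theta> d j = w"
    and rep_unique: "i \<in> J \<Longrightarrow> j \<in> J \<Longrightarrow> d \<in> carrier D \<Longrightarrow> \<theta> d i = j \<Longrightarrow> i = j"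
    and no_core: "N \<subseteq> carrier D \<Longrightarrow> (\<And>n d. n \<in> N \<Longrightarrow> d \<in> carrier D \<Longrightarrow> inv d \<otimes> n \<otimes> d \<in> N) \<Longrightarrow>
      (\<And>n j. n \<in> N \<Longrightarrow> j \<in> J \<Longrightarrow> n \<in> stabilizer D \<theta> j \<and> \<sigma> j n \<in> N) \<Longrightarrow> N \<subseteq> {\<one>}"
begin

definition rp :: "'a \<Rightarrow> 'a" where "rp w = (SOME j. j \<in> J \<and> (\<exists>d\<in>carrier D. \<theta> d j = w))"

definition t :: "'a \<Rightarrow> 'd" where "t w = (SOME d. d \<in> carrier D \<and> \<theta> d (rp w) = w)"

text \<open>Conjugating by \<open>t w\<close> spreads the one involution per orbit to one per point
  of \<open>\<Omega>\<close>: the double coset of \<open>twist j\<close> splits into left cosets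
  indexed by the orbit of \<open>j\<close>.\<close>

definition a :: "'a \<Rightarrow> 'd \<times> 'a set \<Rightarrow> 'd \<times> 'a set" where
  "a w = transl (t w) \<circ> twist (rp w) \<circ> transl (inv (t w))"

lemma rp: "w \<in> \<Omega> \<Longrightarrow> rp w \<in> J"
  and t: "w \<in> \<Omega> \<Longrightarrow> t w \<in> carrier D"
  and t_rp: "w \<in> \<Omega> \<Longrightarrow> \<theta> (t w) (rp w) = w"
proof -
  assume w: "w \<in> \<Omega>"
  have "rp w \<in> J \<and> (\<exists>d\<in>carrier D. \<theta> d (rp w) = w)"
    unfolding rp_def by (rule someI_ex) (use ex_rep[OF w] in blast)
  then have 1: "rp w \<in> J" and 2: "\<exists>d. d \<in> carrier D \<and> \<theta> d (rp w) = w" by blast+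
  show "rp w \<in> J" by (rule 1)
  show "t w \<in> carrier D" "\<theta> (t w) (rp w) = w"
    using someI_ex[OF 2] unfolding t_def[symmetric] by blast+
qed

lemma \<theta>_closed: "d \<in> carrier D \<Longrightarrow> w \<in> \<Omega> \<Longrightarrow> \<theta> d w \<in> \<Omega>"
  by (rule action.element_image) auto

lemma \<theta>_inv:
  assumes "d \<in> carrier D" "w \<in> \<Omega>" "\<theta> d w = u" shows "\<theta> (inv d) u = w"
  using action.orbit_sym_aux assms by blast

lemma rp_J: assumes "j \<in> J" shows "rp j = j"
proof -
  have "j \<in> \<Omega>" using assms J_\<Omega> by blast
  then show ?thesis using rep_unique[OF rp assms t t_rp] by blast
qed

lemma transl_inv_l: "d \<in> carrier D \<Longrightarrow> transl (inv d) \<circ> transl d = id"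
  and transl_inv_r: "d \<in> carrier D \<Longrightarrow> transl d \<circ> transl (inv d) = id"
  by (simp_all add: transl_mult[symmetric] transl_one)

lemma twist_o_twist: "j \<in> J \<Longrightarrow> twist j \<circ> twist j = id"
  using twist_twist by (auto simp: fun_eq_iff)

lemma transl_conj_iff:
  assumes "d \<in> carrier D" "e \<in> carrier D"
  shows "transl d \<circ> p \<circ> transl e \<in> transl ` carrier D \<longleftrightarrow> p \<in> transl ` carrier D"
proof
  assume "transl d \<circ> p \<circ> transl e \<in> transl ` carrier D"
  then obtain f where f: "f \<in> carrier D" "transl d \<circ> p \<circ> transl e = transl f" by blast
  have "p = (transl (inv d) \<circ> transl d) \<circ> p \<circ> (transl e \<circ> transl (inv e))"
    using assms by (simp add: transl_inv_l transl_inv_r)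
  also have "\<dots> = transl (inv d) \<circ> (transl d \<circ> p \<circ> transl e) \<circ> transl (inv e)" by (simp only: o_assoc)
  also have "\<dots> = transl (inv d \<otimes> f \<otimes> inv e)" using f assms by (simp add: transl_mult)
  finally show "p \<in> transl ` carrier D" using f assms by blast
next
  assume "p \<in> transl ` carrier D"
  then obtain f where f: "f \<in> carrier D" "p = transl f" by blast
  then have "transl d \<circ> p \<circ> transl e = transl (d \<otimes> f \<otimes> e)" using assms by (simp add: transl_mult)
  then show "transl d \<circ> p \<circ> transl e \<in> transl ` carrier D" using f assms by blast
qed

lemma a_o_a: assumes "w \<in> \<Omega>" shows "a w \<circ> a w = id"
proof -
  have "a w \<circ> a w = transl (t w) \<circ> (twist (rp w) \<circ> (transl (inv (t w)) \<circ> transl (t w)) \<circ> twist (rp w)) \<circ> transl (inv (t w))"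
    unfolding a_def by (simp only: o_assoc)
  then show ?thesis
    using assms by (simp add: transl_inv_l transl_inv_r t rp twist_o_twist)
qed

lemma a_K: "w \<in> \<Omega> \<Longrightarrow> a w \<in> carrier K"
  using monoid.m_closed[OF group.is_monoid[OF group_K]] transl_K twist_K t rp by (simp add: a_def)

lemma inv_a: assumes "w \<in> \<Omega>" shows "inv\<^bsub>K\<^esub> (a w) = a w"
  by (rule group.inv_equality[OF group_K]) (use assms a_o_a a_K in simp_all)

text \<open>As \<open>a w'\<close> is its own inverse, this decides when \<open>a w'\<close> and
  \<open>transl h \<circ> a w\<close> share a left coset. Stripping the outer translations leaves
  two twists around \<open>d\<close>, which would have to carry \<open>rp w\<close> to
  \<open>rp w'\<close>. By \<open>twist_transl_twist\<close> the product is a translation only if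
  the representatives agree and \<open>d\<close> fixes them; \<open>twist_transl\<close> gives the
  converse.\<close>

lemma a_transl_a:
  assumes w: "w \<in> \<Omega>" "w' \<in> \<Omega>" and h: "h \<in> carrier D"
  shows "a w' \<circ> (transl h \<circ> a w) \<in> transl ` carrier D \<longleftrightarrow> \<theta> h w = w'"
proof -
  define d where "d = inv (t w') \<otimes> h \<otimes> t w"
  have d: "d \<in> carrier D" using w h t by (simp add: d_def)
  have "transl (inv (t w')) \<circ> transl h \<circ> transl (t w) = transl d"
    using w h t by (simp add: d_def transl_mult)
  then have "a w' \<circ> (transl h \<circ> a w) = transl (t w') \<circ> (twist (rp w') \<circ> transl d \<circ> twist (rp w)) \<circ> transl (inv (t w))"
    unfolding a_def by (simp only: o_assoc[symmetric]) (simp only: o_assoc)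
  then have 1: "a w' \<circ> (transl h \<circ> a w) \<in> transl ` carrier D
      \<longleftrightarrow> twist (rp w') \<circ> transl d \<circ> twist (rp w) \<in> transl ` carrier D"
    using transl_conj_iff t w by simp
  have rw: "rp w \<in> \<Omega>" "rp w' \<in> \<Omega>" using rp w J_\<Omega> by blast+
  have \<theta>_d: "\<theta> d (rp w) = \<theta> (inv (t w')) (\<theta> h w)"
    using w h t rw \<theta>_closed t_rp unfolding d_def
    by (simp add: action.composition_rule)
  have 2: "\<theta> d (rp w) = rp w' \<longleftrightarrow> \<theta> h w = w'"
  proof
    assume "\<theta> h w = w'"
    then show "\<theta> d (rp w) = rp w'"
      using \<theta>_d \<theta>_inv[OF t[OF w(2)] rw(2) t_rp[OF w(2)]] by simp
  next
    assume "\<theta> d (rp w) = rp w'"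
    then have "\<theta> (t w') (\<theta> (inv (t w')) (\<theta> h w)) = w'"
      using \<theta>_d t_rp w by simp
    moreover have "\<theta> (t w') (\<theta> (inv (t w')) (\<theta> h w)) = \<theta> h w"
      using \<theta>_inv[of "inv (t w')" "\<theta> h w"] t w \<theta>_closed h by simp
    ultimately show "\<theta> h w = w'" by simp
  qed
  have "twist (rp w') \<circ> transl d \<circ> twist (rp w) \<in> transl ` carrier D \<longleftrightarrow> \<theta> d (rp w) = rp w'"
  proof
    assume "twist (rp w') \<circ> transl d \<circ> twist (rp w) \<in> transl ` carrier D"
    then obtain e where "twist (rp w') \<circ> transl d \<circ> twist (rp w) = transl e" by blast
    from twist_transl_twist[OF rp[OF w(2)] rp[OF w(1)] d this] show "\<theta> d (rp w) = rp w'"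
      by (simp add: stabilizer_def)
  next
    assume dr: "\<theta> d (rp w) = rp w'"
    with rep_unique[OF rp[OF w(1)] rp[OF w(2)] d] have e: "rp w' = rp w" by simp
    then have ds: "d \<in> stabilizer D \<theta> (rp w)" using dr d by (simp add: stabilizer_def)
    then have "twist (rp w') \<circ> transl d \<circ> twist (rp w) = transl (\<sigma> (rp w) d)"
      using twist_transl[OF rp[OF w(1)]] e by simp
    moreover have "\<sigma> (rp w) d \<in> carrier D" using BD \<sigma>_closed rp w ds by blast
    ultimately show "twist (rp w') \<circ> transl d \<circ> twist (rp w) \<in> transl ` carrier D" by simp
  qed
  with 1 2 show ?thesis by simp
qed

lemma a_notin: assumes "w \<in> \<Omega>" shows "a w \<notin> transl ` carrier D"
  using transl_conj_iff[of "t w" "inv (t w)" "twist (rp w)"] twist_not_transl[OF rp[OF assms]] t[OF assms]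
  by (auto simp: a_def)

lemma generate_a: "generate K (transl ` carrier D \<union> a ` \<Omega>) = carrier K"
proof
  interpret K: group K by (rule group_K)
  let ?S = "transl ` carrier D \<union> a ` \<Omega>"
  have S: "?S \<subseteq> carrier K" using transl_K a_K by blast
  then show "generate K ?S \<subseteq> carrier K" by (rule K.generate_incl)
  have "twist j \<in> generate K ?S" if j: "j \<in> J" for j
  proof -
    have jO: "j \<in> \<Omega>" using j J_\<Omega> by blast
    then have tj: "t j \<in> carrier D" by (rule t)
    \<comment> \<open>Although \<open>rp j\<close> is \<open>j\<close>, the chosen
      \<open>t j\<close> is only known to stabilise \<open>j\<close>, so the conjugation has to be
      undone.\<close>
    have "transl (inv (t j)) \<circ> (a j \<circ> transl (t j))
        = (transl (inv (t j)) \<circ> transl (t j)) \<circ> twist j \<circ> (transl (inv (t j)) \<circ> transl (t j))"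
      unfolding a_def rp_J[OF j] by (simp only: o_assoc)
    also have "\<dots> = twist j" using tj by (simp add: transl_inv_l)
    finally have e: "twist j = transl (inv (t j)) \<otimes>\<^bsub>K\<^esub> (a j \<otimes>\<^bsub>K\<^esub> transl (t j))" by simp
    show ?thesis
      unfolding e by (intro generate.eng generate.incl) (use tj jO in auto)
  qed
  then have "transl ` carrier D \<union> twist ` J \<subseteq> generate K ?S" by (auto intro: generate.incl)
  then have "generate K (transl ` carrier D \<union> twist ` J) \<subseteq> generate K ?S"
    by (rule K.generate_subgroup_incl[OF _ K.generate_is_subgroup[OF S]])
  moreover have "generate K (transl ` carrier D \<union> twist ` J) = carrier K"
    using generate_K[of "transl ` carrier D \<union> twist ` J"] transl_K twist_K carrier_K by auto
  ultimately show "carrier K \<subseteq> generate K ?S" by simp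
qed

text \<open>The elements whose translations stay translations under all conjugations by
  \<open>K\<close> form a set \<open>N\<close> to which \<open>no_core\<close> applies: conjugation
  by \<open>twist j\<close> forces them into the stabiliser of \<open>j\<close> and acts on them as
  \<open>\<sigma> j\<close>.\<close>

lemma core_trivial:
  assumes h: "h \<in> transl ` carrier D"
    and core: "\<And>x. x \<in> carrier K \<Longrightarrow> inv\<^bsub>K\<^esub> x \<otimes>\<^bsub>K\<^esub> h \<otimes>\<^bsub>K\<^esub> x \<in> transl ` carrier D"
  shows "h = \<one>\<^bsub>K\<^esub>"
proof -
  interpret K: group K by (rule group_K)
  interpret transl: group_hom D K transl by (rule transl_hom)
  define N where "N = {n \<in> carrier D. \<forall>x\<in>carrier K. inv\<^bsub>K\<^esub> x \<otimes>\<^bsub>K\<^esub> transl n \<otimes>\<^bsub>K\<^esub> x \<in> transl ` carrier D}"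
  \<comment> \<open>Conjugating by \<open>y\<close> and then by \<open>x\<close> is conjugating by
    their product, so \<open>N\<close> is closed under conjugation in \<open>K\<close>.\<close>
  have N: "e \<in> N" if n: "n \<in> N" and y: "y \<in> carrier K" and e: "e \<in> carrier D"
    and ye: "inv\<^bsub>K\<^esub> y \<otimes>\<^bsub>K\<^esub> transl n \<otimes>\<^bsub>K\<^esub> y = transl e" for n y e
  proof -
    have "inv\<^bsub>K\<^esub> x \<otimes>\<^bsub>K\<^esub> transl e \<otimes>\<^bsub>K\<^esub> x \<in> transl ` carrier D" if x: "x \<in> carrier K" for x
    proof -
      have nD: "n \<in> carrier D" using n by (simp add: N_def)
      have "inv\<^bsub>K\<^esub> x \<otimes>\<^bsub>K\<^esub> transl e \<otimes>\<^bsub>K\<^esub> x = inv\<^bsub>K\<^esub> (y \<otimes>\<^bsub>K\<^esub> x) \<otimes>\<^bsub>K\<^esub> transl n \<otimes>\<^bsub>K\<^esub> (y \<otimes>\<^bsub>K\<^esub> x)"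
        unfolding ye[symmetric] using x y nD transl_K
        by (simp add: K.inv_mult_group K.m_assoc del: K_simps)
      then show ?thesis using n K.m_closed[OF y x] unfolding N_def by simp
    qed
    then show "e \<in> N" using e by (simp add: N_def)
  qed
  have "N \<subseteq> {\<one>}"
  proof (rule no_core)
    show "N \<subseteq> carrier D" by (auto simp: N_def)
  next
    fix n d assume n: "n \<in> N" and d: "d \<in> carrier D"
    have nD: "n \<in> carrier D" using n by (simp add: N_def)
    have "inv\<^bsub>K\<^esub> transl d \<otimes>\<^bsub>K\<^esub> transl n \<otimes>\<^bsub>K\<^esub> transl d = transl (inv d \<otimes> n \<otimes> d)"
      using d nD by (simp del: K_simps)
    then show "inv d \<otimes> n \<otimes> d \<in> N" using N[OF n transl_K[OF d]] d nD by simp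
  next
    fix n j assume n: "n \<in> N" and j: "j \<in> J"
    have nD: "n \<in> carrier D" using n by (simp add: N_def)
    have "inv\<^bsub>K\<^esub> twist j = twist j"
      by (rule K.inv_equality) (use j twist_o_twist twist_K in simp_all)
    then have tn: "inv\<^bsub>K\<^esub> twist j \<otimes>\<^bsub>K\<^esub> transl n \<otimes>\<^bsub>K\<^esub> twist j = twist j \<circ> transl n \<circ> twist j" by simp
    moreover have "inv\<^bsub>K\<^esub> twist j \<otimes>\<^bsub>K\<^esub> transl n \<otimes>\<^bsub>K\<^esub> twist j \<in> transl ` carrier D"
      using n twist_K[OF j] unfolding N_def by blast
    ultimately obtain e where "twist j \<circ> transl n \<circ> twist j = transl e" by auto
    from twist_transl_twist(2)[OF j j nD this] have ns: "n \<in> stabilizer D \<theta> j" .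
    moreover have "\<sigma> j n \<in> N"
      using N[OF n twist_K[OF j] BD[OF j \<sigma>_closed[OF j ns]]] tn twist_transl[OF j ns] by simp
    ultimately show "n \<in> stabilizer D \<theta> j \<and> \<sigma> j n \<in> N" by blast
  qed
  moreover obtain n where n: "n \<in> carrier D" "h = transl n" using h by blast
  moreover have "n \<in> N" using n core unfolding N_def by blast
  ultimately have "n = \<one>" by blast
  then show ?thesis using n transl_one by simp
qed

lemma exists_locally_pair:
  "\<exists>(\<Gamma> :: nat pair_pre_digraph) G. locally_pair \<Omega> (\<theta> ` carrier D) \<Gamma> G \<and>
     pverts \<Gamma> \<noteq> {} \<and>
     (\<forall>v\<in>pverts \<Gamma>. card (point_stabilizer (pverts \<Gamma>) G v) = card (carrier D))"
proof -
  interpret K: group K by (rule group_K)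
  have H: "subgroup (transl ` carrier D) K" by (rule group_hom.img_is_subgroup[OF transl_hom])
  obtain c :: "('d \<times> 'a set \<Rightarrow> 'd \<times> 'a set) \<Rightarrow> nat" where c:
    "\<And>x y. x \<in> carrier K \<Longrightarrow> y \<in> carrier K \<Longrightarrow> c x = c y \<longleftrightarrow> inv\<^bsub>K\<^esub> x \<otimes>\<^bsub>K\<^esub> y \<in> transl ` carrier D"
    using K.exists_coset_labelling[OF finite_K H] by blast
  \<comment> \<open>Injectivity of \<open>transl\<close> lets the element of \<open>D\<close>, and
    with it its action, be read off from the translation.\<close>
  define act where "act h = \<theta> (inv_into (carrier D) transl h)" for h
  have act: "act (transl d) = \<theta> d" if "d \<in> carrier D" for d
    using that transl_inj by (simp add: act_def)
  \<comment> \<open>This one equivalence supplies both \<open>a_inj\<close>, with \<open>d\<close>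
    equal to \<open>\<one>\<close>, and \<open>a_act\<close>.\<close>
  have move: "c (a w') = c (transl d \<otimes>\<^bsub>K\<^esub> a w) \<longleftrightarrow> \<theta> d w = w'"
    if "w \<in> \<Omega>" "w' \<in> \<Omega>" "d \<in> carrier D" for w w' d
    using that c[OF a_K[OF that(2)] K.m_closed[OF transl_K[OF that(3)] a_K[OF that(1)]]] a_transl_a[OF that]
    by (simp add: inv_a)
  interpret coset_graph K "transl ` carrier D" a act \<Omega> "\<theta> ` carrier D" c
  proof (intro coset_graph.intro coset_graph_axioms.intro group_K)
    show "finite (carrier K)" by (rule finite_K)
    show "subgroup (transl ` carrier D) K" by (rule H)
    show "subgroup (\<theta> ` carrier D) (BijGroup \<Omega>)"
      by (rule group_hom.img_is_subgroup[OF action.group_hom])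
    show "act ` transl ` carrier D = \<theta> ` carrier D" using act by (simp add: image_image)
    show "c x = c y \<longleftrightarrow> inv\<^bsub>K\<^esub> x \<otimes>\<^bsub>K\<^esub> y \<in> transl ` carrier D"
      if "x \<in> carrier K" "y \<in> carrier K" for x y by (rule c[OF that])
    show "a w \<in> carrier K" if "w \<in> \<Omega>" for w by (rule a_K[OF that])
    show "a w \<otimes>\<^bsub>K\<^esub> a w = \<one>\<^bsub>K\<^esub>" if "w \<in> \<Omega>" for w using a_o_a[OF that] by simp
    show "a w \<notin> transl ` carrier D" if "w \<in> \<Omega>" for w by (rule a_notin[OF that])
    show "w = w'" if "w \<in> \<Omega>" "w' \<in> \<Omega>" "c (a w) = c (a w')" for w w'
    proof -
      have "c (a w) = c (transl \<one> \<otimes>\<^bsub>K\<^esub> a w')" using that(3) by (simp add: transl_one)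
      then have "\<theta> \<one> w' = w" using move[OF that(2,1) one_closed] by simp
      then show ?thesis unfolding action.id_eq_one[symmetric] restrict_apply'[OF that(2)] by (rule sym)
    qed
    show "c (h \<otimes>\<^bsub>K\<^esub> a w) = c (a (act h w))" if h: "h \<in> transl ` carrier D" and w: "w \<in> \<Omega>" for h w
    proof -
      obtain d where d: "d \<in> carrier D" "h = transl d" using h by blast
      have "c (a (\<theta> d w)) = c (transl d \<otimes>\<^bsub>K\<^esub> a w)"
        using move[OF w \<theta>_closed[OF d(1) w] d(1)] by blast
      then show ?thesis unfolding d(2) act[OF d(1)] ..
    qed
    show "generate K (transl ` carrier D \<union> a ` \<Omega>) = carrier K" by (rule generate_a)
    show "h = \<one>\<^bsub>K\<^esub>" if "h \<in> transl ` carrier D"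
      "\<And>x. x \<in> carrier K \<Longrightarrow> inv\<^bsub>K\<^esub> x \<otimes>\<^bsub>K\<^esub> h \<otimes>\<^bsub>K\<^esub> x \<in> transl ` carrier D" for h
      by (rule core_trivial[OF that])
  qed
  have "card (transl ` carrier D) = card (carrier D)" by (rule card_image[OF transl_inj])
  then have "\<forall>v\<in>pverts \<Gamma>. card (point_stabilizer (pverts \<Gamma>) (\<Phi> ` carrier K) v) = card (carrier D)"
    using card_stabilizer unfolding pverts_\<Gamma> by simp
  moreover have "pverts \<Gamma> \<noteq> {}" unfolding pverts_\<Gamma> V_def using K.one_closed by blast
  ultimately show ?thesis using locally_pair_\<Gamma> by blast
qed

end

section \<open>Unbounded vertex stabilisers from two orbits and one non-trivial point
  stabiliser\<close>

section \<open>Large vertex stabilisers\<close>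

lemma (in group_action) exists_orbit_transversal:
  assumes z: "z \<in> E"
  shows "\<exists>J\<subseteq>E. z \<in> J \<and> (\<forall>w\<in>E. \<exists>j\<in>J. \<exists>g\<in>carrier G. \<phi> g j = w) \<and>
    (\<forall>i\<in>J. \<forall>j\<in>J. \<forall>g\<in>carrier G. \<phi> g i = j \<longrightarrow> i = j)"
proof -
  \<comment> \<open>The orbit of \<open>z\<close> must be represented by \<open>z\<close> itself,
    whose stabiliser is the one known to be non-trivial.\<close>
  define rep where "rep C = (if z \<in> C then z else SOME u. u \<in> C)" for C
  have refl: "w \<in> orbit G \<phi> w" if "w \<in> E" for w using orbit_refl[OF that] .
  have orbD: "\<exists>g\<in>carrier G. \<phi> g x = w" if "w \<in> orbit G \<phi> x" for w x
    using that by (auto simp: orbit_def)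
  have rep: "rep (orbit G \<phi> w) \<in> orbit G \<phi> w" if "w \<in> E" for w
    using refl[OF that] unfolding rep_def by (auto intro: someI)
  have orbE: "u \<in> E" if "w \<in> E" "u \<in> orbit G \<phi> w" for w u
    using that element_image unfolding orbit_def by blast
  have orb_eq: "orbit G \<phi> u = orbit G \<phi> w" if w: "w \<in> E" and u: "u \<in> orbit G \<phi> w" for w u
  proof -
    have uE: "u \<in> E" by (rule orbE[OF w u])
    have wu: "w \<in> orbit G \<phi> u" by (rule orbit_sym[OF w uE u])
    show ?thesis
      using orbit_trans[OF w uE _ u] orbit_trans[OF uE w _ wu] orbE w uE by blast
  qed
  define J where "J = (\<lambda>w. rep (orbit G \<phi> w)) ` E"
  have fix_rep: "rep (orbit G \<phi> j) = j" if j: "j \<in> J" for j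
  proof -
    obtain w where w: "w \<in> E" "j = rep (orbit G \<phi> w)" using j by (auto simp: J_def)
    then show ?thesis using orb_eq[OF w(1) rep[OF w(1)]] by simp
  qed
  have JE: "J \<subseteq> E" using orbE rep unfolding J_def by blast
  have "rep (orbit G \<phi> z) = z" using refl[OF z] by (simp add: rep_def)
  then have "z \<in> J" unfolding J_def using z by (metis imageI)
  moreover have "\<exists>j\<in>J. \<exists>g\<in>carrier G. \<phi> g j = w" if w: "w \<in> E" for w
  proof -
    let ?j = "rep (orbit G \<phi> w)"
    have "w \<in> orbit G \<phi> ?j" using orb_eq[OF w rep[OF w]] refl[OF w] by simp
    then have "\<exists>g\<in>carrier G. \<phi> g ?j = w" by (rule orbD)
    then show ?thesis using w unfolding J_def by blast
  qed
  moreover have "i = j" if ij: "i \<in> J" "j \<in> J" "g \<in> carrier G" "\<phi> g i = j" for i j g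
  proof -
    have "j \<in> orbit G \<phi> i" using ij(3,4) by (auto simp: orbit_def)
    then have "orbit G \<phi> j = orbit G \<phi> i" using orb_eq ij(1) JE by blast
    then show ?thesis using fix_rep[OF ij(1)] fix_rep[OF ij(2)] by simp
  qed
  ultimately show ?thesis using JE by blast
qed

text \<open>The points \<open>z\<close> and \<open>z'\<close> represent different orbits,
  \<open>p\<close> witnesses that the stabiliser of \<open>z\<close> is non-trivial, and
  \<open>n\<close> is a free parameter controlling the size.\<close>

locale intransitive_nonsemiregular = group_action G \<Omega> \<theta>
  for G (structure) and \<Omega> :: "'a set" and \<theta> +
  fixes J :: "'a set" and z z' :: 'a and p and n :: nat
  assumes finite_G: "finite (carrier G)" and finite_\<Omega>: "finite \<Omega>"
    and faithful: "g \<in> carrier G \<Longrightarrow> (\<And>x. x \<in> \<Omega> \<Longrightarrow> \<theta> g x = x) \<Longrightarrow> g = \<one>"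
    and J: "J \<subseteq> \<Omega>" "z \<in> J" "z' \<in> J" "z \<noteq> z'"
    and cover: "w \<in> \<Omega> \<Longrightarrow> \<exists>j\<in>J. \<exists>g\<in>carrier G. \<theta> g j = w"
    and separate: "i \<in> J \<Longrightarrow> j \<in> J \<Longrightarrow> g \<in> carrier G \<Longrightarrow> \<theta> g i = j \<Longrightarrow> i = j"
    and p: "p \<in> stabilizer G \<theta> z" "p \<noteq> \<one>"
begin

sublocale G: group G using group_hom group_hom.axioms(1) by blast

definition C :: "nat \<Rightarrow> 'b set" where
  "C i = (if i = 0 then carrier G else stabilizer G \<theta> z)"

definition D :: "(nat \<Rightarrow> 'b) monoid" where
  "D = product_group {..n} (\<lambda>i. G\<lparr>carrier := C i\<rparr>)"

text \<open>Two kinds of reflection of the index set, about \<open>n/2\<close> and, with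
  \<open>0\<close> kept fixed, about \<open>(n+1)/2\<close>; composing them shifts indices by
  one.\<close>

definition \<pi> :: "'a \<Rightarrow> nat \<Rightarrow> nat" where
  "\<pi> j i = (if j = z then n - i else if i = 0 then 0 else Suc n - i)"

definition \<sigma> :: "'a \<Rightarrow> (nat \<Rightarrow> 'b) \<Rightarrow> nat \<Rightarrow> 'b" where
  "\<sigma> j f = (\<lambda>i\<in>{..n}. f (\<pi> j i))"

definition \<Theta> :: "(nat \<Rightarrow> 'b) \<Rightarrow> 'a \<Rightarrow> 'a" where
  "\<Theta> f = \<theta> (f 0)"

lemma stab_z: "subgroup (stabilizer G \<theta> z) G"
  using stabilizer_subgroup J by blast

lemma C_subgroup: "subgroup (C i) G"
  by (simp add: C_def stab_z G.subgroup_self)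

lemma C_G: "x \<in> C i \<Longrightarrow> x \<in> carrier G"
  using subgroup.subset[OF C_subgroup] by blast

lemma group_C: "group (G\<lparr>carrier := C i\<rparr>)"
  by (rule subgroup.subgroup_is_group[OF C_subgroup G.is_group])

lemma carrier_D: "carrier D = (\<Pi>\<^sub>E i\<in>{..n}. C i)"
  by (simp add: D_def)

lemma D_G: "f \<in> carrier D \<Longrightarrow> i \<le> n \<Longrightarrow> f i \<in> carrier G"
  using C_G by (auto simp: carrier_D PiE_iff)

lemma group_D: "group D"
  unfolding D_def by (rule product_group) (rule group_C)

lemma mult_D: "f \<otimes>\<^bsub>D\<^esub> g = (\<lambda>i\<in>{..n}. f i \<otimes> g i)"
  by (simp add: D_def)

lemma one_D: "\<one>\<^bsub>D\<^esub> = (\<lambda>i\<in>{..n}. \<one>)"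
  by (simp add: D_def)

lemma inv_D:
  assumes "f \<in> carrier D" shows "inv\<^bsub>D\<^esub> f = (\<lambda>i\<in>{..n}. inv (f i))"
proof -
  have "inv\<^bsub>D\<^esub> f = (\<lambda>i\<in>{..n}. inv\<^bsub>G\<lparr>carrier := C i\<rparr>\<^esub> f i)"
    using assms unfolding D_def by (intro inv_product_group group_C) simp
  also have "\<dots> = (\<lambda>i\<in>{..n}. inv (f i))"
  proof (rule restrict_ext)
    fix i assume "i \<in> {..n}"
    then have "f i \<in> C i" using assms by (auto simp: carrier_D)
    then show "inv\<^bsub>G\<lparr>carrier := C i\<rparr>\<^esub> f i = inv (f i)"
      by (rule G.m_inv_consistent[OF C_subgroup])
  qed
  finally show ?thesis .
qed

lemma finite_D: "finite (carrier D)"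
proof -
  have "finite (C i)" for i using finite_G C_G by (meson finite_subset subsetI)
  then show ?thesis unfolding carrier_D by (intro finite_PiE) auto
qed

text \<open>Every factor contains \<open>\<one>\<close> and \<open>p\<close>, so the order is at
  least \<open>2 ^ Suc n\<close>.\<close>

lemma card_D: "n < card (carrier D)"
proof -
  have "2 \<le> card (C i)" for i
  proof -
    have "{\<one>, p} \<subseteq> C i"
      using p subgroup.one_closed[OF stab_z] subgroup.subset[OF stab_z] by (auto simp: C_def)
    moreover have "finite (C i)" using finite_G C_G by (meson finite_subset subsetI)
    ultimately have "card {\<one>, p} \<le> card (C i)" by (rule card_mono[rotated])
    then show ?thesis using p(2) by simp
  qed
  then have "(\<Prod>i\<in>{..n}. 2) \<le> (\<Prod>i\<in>{..n}. card (C i))" by (intro prod_mono) auto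
  moreover have "n < 2 ^ Suc n" using less_exp[of "Suc n"] by linarith
  ultimately show ?thesis by (simp add: carrier_D card_PiE)
qed

lemma action_D: "group_action D \<Omega> \<Theta>"
proof -
  have "(\<lambda>f. f 0) \<in> hom D G"
    using D_G by (intro homI) (simp_all add: mult_D)
  then have "(\<theta> \<circ> (\<lambda>f. f 0)) \<in> hom D (BijGroup \<Omega>)"
    using group_hom.homh[OF group_hom] by (rule hom_compose)
  moreover have "\<theta> \<circ> (\<lambda>f. f 0) = \<Theta>" by (auto simp: \<Theta>_def)
  ultimately show ?thesis
    unfolding group_action_def group_hom_def group_hom_axioms_def
    using group_D group_BijGroup by metis
qed

lemma \<Theta>_image: "\<Theta> ` carrier D = \<theta> ` carrier G"
proof
  show "\<Theta> ` carrier D \<subseteq> \<theta> ` carrier G" using D_G by (auto simp: \<Theta>_def)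
  have "\<theta> g \<in> \<Theta> ` carrier D" if "g \<in> carrier G" for g
  proof (rule image_eqI)
    show "(\<lambda>i\<in>{..n}. if i = 0 then g else \<one>) \<in> carrier D"
      using that subgroup.one_closed[OF stab_z] by (simp add: carrier_D C_def)
  qed (simp add: \<Theta>_def)
  then show "\<theta> ` carrier G \<subseteq> \<Theta> ` carrier D" by blast
qed

lemma stabilizer_D: "f \<in> stabilizer D \<Theta> j \<longleftrightarrow> f \<in> carrier D \<and> \<theta> (f 0) j = j"
  by (simp add: stabilizer_def \<Theta>_def)

text \<open>Fixing \<open>z\<close> cuts coordinate \<open>0\<close> down to the stabiliser of
  \<open>z\<close>, the group in which all other coordinates already lie. Hence all
  \<open>n + 1\<close> coordinates may be permuted freely, which the reflection for \<open>z\<close>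
  exploits.\<close>

lemma stabilizer_D_z:
  "f \<in> stabilizer D \<Theta> z \<longleftrightarrow> f \<in> extensional {..n} \<and> (\<forall>i\<le>n. f i \<in> stabilizer G \<theta> z)"
  (is "?l \<longleftrightarrow> ?r")
proof
  assume ?l
  then have f: "f \<in> (\<Pi>\<^sub>E i\<in>{..n}. C i)" "\<theta> (f 0) z = z"
    unfolding stabilizer_D carrier_D by blast+
  have "f i \<in> stabilizer G \<theta> z" if i: "i \<le> n" for i
  proof -
    have "f i \<in> C i" using PiE_mem[OF f(1)] i by simp
    then show ?thesis using f(2) by (cases "i = 0") (simp_all add: C_def stabilizer_def)
  qed
  then show ?r using f(1) unfolding PiE_def by blast
next
  assume r: ?r
  then have "f i \<in> C i" if "i \<le> n" for i
    using that subgroup.subset[OF stab_z] by (auto simp: C_def)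
  moreover have "\<theta> (f 0) z = z" using r unfolding stabilizer_def by blast
  ultimately show ?l using r by (simp add: stabilizer_D carrier_D PiE_iff)
qed

lemma \<pi>_le: "i \<le> n \<Longrightarrow> \<pi> j i \<le> n"
  and \<pi>_\<pi>: "i \<le> n \<Longrightarrow> \<pi> j (\<pi> j i) = i"
  by (auto simp: \<pi>_def)

text \<open>For \<open>j\<close> other than \<open>z\<close>, coordinate \<open>0\<close>, which
  alone acts, stays in place, and the remaining coordinates all have the same factor group.\<close>

lemma \<sigma>_closed:
  assumes f: "f \<in> stabilizer D \<Theta> j" shows "\<sigma> j f \<in> stabilizer D \<Theta> j"
proof (cases "j = z")
  case True
  then show ?thesis using f \<pi>_le by (simp add: stabilizer_D_z \<sigma>_def)
next
  case False
  have "\<sigma> j f i \<in> C i" if i: "i \<le> n" for i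
  proof -
    have "f (\<pi> j i) \<in> C (\<pi> j i)" using f \<pi>_le[OF i] by (auto simp: stabilizer_D carrier_D)
    moreover have "C (\<pi> j i) = C i" using False i by (auto simp: C_def \<pi>_def)
    ultimately show ?thesis using i by (simp add: \<sigma>_def)
  qed
  then have "\<sigma> j f \<in> carrier D" by (simp add: carrier_D PiE_iff \<sigma>_def)
  moreover have "\<sigma> j f 0 = f 0" using False by (simp add: \<sigma>_def \<pi>_def)
  ultimately show ?thesis using f by (simp add: stabilizer_D)
qed

lemma no_core:
  assumes N: "N \<subseteq> carrier D"
    and conj: "\<And>f d. f \<in> N \<Longrightarrow> d \<in> carrier D \<Longrightarrow> inv\<^bsub>D\<^esub> d \<otimes>\<^bsub>D\<^esub> f \<otimes>\<^bsub>D\<^esub> d \<in> N"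
    and stab: "\<And>f j. f \<in> N \<Longrightarrow> j \<in> J \<Longrightarrow> f \<in> stabilizer D \<Theta> j \<and> \<sigma> j f \<in> N"
  shows "N \<subseteq> {\<one>\<^bsub>D\<^esub>}"
proof
  \<comment> \<open>By faithfulness it is enough that \<open>f 0\<close> fixes every
    \<open>w\<close>. Some \<open>g\<close> carries a point \<open>j\<close> of \<open>J\<close> to
    \<open>w\<close>; conjugating \<open>f\<close> by a lift of \<open>g\<close> gives a member of
    \<open>N\<close>, which fixes \<open>j\<close>, so \<open>f 0\<close> fixes
    \<open>w\<close>.\<close>
  have 0: "f 0 = \<one>" if f: "f \<in> N" for f
  proof (rule faithful)
    have f0: "f 0 \<in> carrier G" using f N D_G by blast
    then show "f 0 \<in> carrier G" .
    fix w assume "w \<in> \<Omega>"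
    then obtain j g where j: "j \<in> J" "g \<in> carrier G" "\<theta> g j = w" using cover by blast
    define d where "d = (\<lambda>i\<in>{..n}. if i = 0 then g else \<one>)"
    have d: "d \<in> carrier D"
      using j subgroup.one_closed[OF stab_z] by (simp add: carrier_D C_def d_def)
    have d0: "(inv\<^bsub>D\<^esub> d \<otimes>\<^bsub>D\<^esub> f \<otimes>\<^bsub>D\<^esub> d) 0 = inv g \<otimes> f 0 \<otimes> g"
      by (simp add: mult_D inv_D[OF d]) (simp add: d_def)
    have jO: "j \<in> \<Omega>" using j J by blast
    have "\<theta> (inv g \<otimes> f 0 \<otimes> g) j = j"
      using stab[OF conj[OF f d] j(1)] unfolding stabilizer_D d0 by blast
    then have "\<theta> (g \<otimes> (inv g \<otimes> f 0 \<otimes> g)) j = w"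
      using j jO f0 by (simp add: composition_rule)
    moreover have "g \<otimes> (inv g \<otimes> f 0 \<otimes> g) = f 0 \<otimes> g"
      using j f0 by (simp add: G.m_assoc G.inv_cancel)
    ultimately show "\<theta> (f 0) w = w"
      using j jO f0 by (simp add: composition_rule)
  qed
  \<comment> \<open>Coordinate \<open>k\<close> leads to \<open>n - k\<close> by \<open>\<sigma> z\<close>, and then to \<open>k + 1\<close> by \<open>\<sigma> z'\<close>.\<close>
  have \<sigma>1: "f (\<pi> j k) = \<one>" if "f \<in> N" "j \<in> J" "k \<le> n" "\<And>f. f \<in> N \<Longrightarrow> f k = \<one>" for f j k
    using that(4)[of "\<sigma> j f"] stab[OF that(1,2)] that(3) by (simp add: \<sigma>_def)
  have all: "f k = \<one>" if "k \<le> n" "f \<in> N" for k f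
    using that
  \<comment> \<open>The element \<open>f\<close> stays arbitrary because the reflections replace it
    by other members of \<open>N\<close>.\<close>
  proof (induction k arbitrary: f)
    case (Suc k)
    have "f (n - k) = \<one>" if "f \<in> N" for f
      using \<sigma>1[OF that J(2), of k] Suc by (simp add: \<pi>_def)
    then have "f (\<pi> z' (n - k)) = \<one>"
      by (intro \<sigma>1[OF Suc.prems(2) J(3)]) auto
    moreover have "\<pi> z' (n - k) = Suc k" using J(4) Suc.prems(1) by (auto simp: \<pi>_def)
    ultimately show ?case by simp
  qed (rule 0)
  fix f assume f: "f \<in> N"
  have "f = (\<lambda>i\<in>{..n}. \<one>)"
    by (rule extensionalityI[where A = "{..n}"]) (use f N all in \<open>auto simp: carrier_D PiE_iff\<close>)
  then show "f \<in> {\<one>\<^bsub>D\<^esub>}" by (simp add: one_D)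
qed

lemma exists_large_locally_pair:
  "\<exists>(\<Gamma> :: nat pair_pre_digraph) A. locally_pair \<Omega> (\<theta> ` carrier G) \<Gamma> A \<and>
     (\<exists>v\<in>pverts \<Gamma>. n < card (point_stabilizer (pverts \<Gamma>) A v))"
proof -
  interpret D: group D by (rule group_D)
  interpret action: group_action D \<Omega> \<Theta> by (rule action_D)
  interpret stabilizer_automorphisms D J \<Theta> \<sigma> \<Omega>
  proof (intro stabilizer_automorphisms.intro partial_automorphisms.intro
      partial_automorphisms_axioms.intro stabilizer_automorphisms_axioms.intro group_D action_D)
    show "finite (carrier D)" by (rule finite_D)
    show "finite J" using J(1) finite_\<Omega> finite_subset by blast
    show "subgroup (stabilizer D \<Theta> j) D" if "j \<in> J" for j
      using action.stabilizer_subgroup that J(1) by blast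
    show "\<sigma> j f \<in> stabilizer D \<Theta> j" if "f \<in> stabilizer D \<Theta> j" for j f
      by (rule \<sigma>_closed[OF that])
    show "\<sigma> j (f \<otimes>\<^bsub>D\<^esub> g) = \<sigma> j f \<otimes>\<^bsub>D\<^esub> \<sigma> j g" for j f g
      unfolding mult_D \<sigma>_def by (rule restrict_ext) (simp add: \<pi>_le)
    show "\<sigma> j (\<sigma> j f) = f" if "f \<in> stabilizer D \<Theta> j" for j f
    proof (rule extensionalityI[where A = "{..n}"])
      show "f \<in> extensional {..n}" using that by (auto simp: stabilizer_D carrier_D PiE_iff)
    qed (simp_all add: \<sigma>_def \<pi>_le \<pi>_\<pi>)
    show "J \<subseteq> \<Omega>" by (rule J(1))
    show "\<exists>j\<in>J. \<exists>d\<in>carrier D. \<Theta> d j = w" if w: "w \<in> \<Omega>" for w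
    proof -
      obtain j g where "j \<in> J" "g \<in> carrier G" "\<theta> g j = w" using cover[OF w] by blast
      moreover obtain d where "d \<in> carrier D" "\<Theta> d = \<theta> g"
        using \<Theta>_image \<open>g \<in> carrier G\<close> by (metis (no_types) imageE imageI)
      ultimately show ?thesis by metis
    qed
    show "i = j" if "i \<in> J" "j \<in> J" "d \<in> carrier D" "\<Theta> d i = j" for i j d
      using separate[OF that(1,2), of "d 0"] D_G[OF that(3)] that(4) by (simp add: \<Theta>_def)
    show "N \<subseteq> {\<one>\<^bsub>D\<^esub>}" if "N \<subseteq> carrier D"
      "\<And>f d. f \<in> N \<Longrightarrow> d \<in> carrier D \<Longrightarrow> inv\<^bsub>D\<^esub> d \<otimes>\<^bsub>D\<^esub> f \<otimes>\<^bsub>D\<^esub> d \<in> N"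
      "\<And>f j. f \<in> N \<Longrightarrow> j \<in> J \<Longrightarrow> f \<in> stabilizer D \<Theta> j \<and> \<sigma> j f \<in> N" for N
      by (rule no_core[OF that])
  qed
  obtain \<Gamma> :: "nat pair_pre_digraph" and A where \<Gamma>:
    "locally_pair \<Omega> (\<Theta> ` carrier D) \<Gamma> A" "pverts \<Gamma> \<noteq> {}"
    "\<forall>v\<in>pverts \<Gamma>. card (point_stabilizer (pverts \<Gamma>) A v) = card (carrier D)"
    using exists_locally_pair by blast
  obtain v where v: "v \<in> pverts \<Gamma>" using \<Gamma>(2) by blast
  have "n < card (point_stabilizer (pverts \<Gamma>) A v)" using \<Gamma>(3) v card_D by simp
  then show ?thesis using \<Gamma>(1) v unfolding \<Theta>_image by blast
qed

end

section \<open>Intransitive graph-restrictive groups are semiregular\<close>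

theorem theorem1p2:
  fixes \<Omega> :: "'a set" and L :: "('a \<Rightarrow> 'a) set"
  assumes "finite \<Omega>"
    and "subgroup L (BijGroup \<Omega>)"
    and "\<not> perm_transitive \<Omega> L"
    and "graph_restrictive \<Omega> L"
  shows "semiregular \<Omega> L"
proof (rule ccontr)
  interpret group_action "perm_group \<Omega> L" \<Omega> "\<lambda>g. g"
    by (rule group_action_perm_group[OF assms(2)])
  have carr: "carrier (perm_group \<Omega> L) = L" by simp
  have LB: "g \<in> Bij \<Omega>" if "g \<in> L" for g
    using subgroup.subset[OF assms(2)] that by (auto simp: BijGroup_simps)
  have "Bij \<Omega> \<subseteq> \<Omega> \<rightarrow>\<^sub>E \<Omega>"
    unfolding PiE_def using Bij_imp_funcset Bij_imp_extensional by blast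
  then have "finite (Bij \<Omega>)" by (rule finite_subset) (simp add: finite_PiE assms(1))
  then have finL: "finite L" using LB by (meson finite_subset subsetI)
  assume "\<not> semiregular \<Omega> L"
  then obtain z where z: "z \<in> \<Omega>" "point_stabilizer \<Omega> L z \<noteq> {\<one>\<^bsub>BijGroup \<Omega>\<^esub>}"
    unfolding semiregular_def by blast
  moreover have "\<one>\<^bsub>BijGroup \<Omega>\<^esub> \<in> point_stabilizer \<Omega> L z"
    using subgroup.one_closed[OF assms(2)] z(1) by (simp add: stabilizer_def BijGroup_simps)
  ultimately obtain p where p: "p \<in> point_stabilizer \<Omega> L z" "p \<noteq> \<one>\<^bsub>BijGroup \<Omega>\<^esub>" by blast
  obtain J where J: "J \<subseteq> \<Omega>" "z \<in> J"
    "\<And>w. w \<in> \<Omega> \<Longrightarrow> \<exists>j\<in>J. \<exists>g\<in>carrier (perm_group \<Omega> L). g j = w"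
    "\<And>i j g. i \<in> J \<Longrightarrow> j \<in> J \<Longrightarrow> g \<in> carrier (perm_group \<Omega> L) \<Longrightarrow> g i = j \<Longrightarrow> i = j"
    using exists_orbit_transversal[OF z(1)] by metis
  \<comment> \<open>If \<open>z\<close> were the only representative, every point would be an image
    of \<open>z\<close>, making \<open>L\<close> transitive.\<close>
  have "\<exists>z'\<in>J. z \<noteq> z'"
  proof (rule ccontr)
    assume "\<not> ?thesis"
    then have Jz: "j = z" if "j \<in> J" for j using that by auto
    interpret P: group "perm_group \<Omega> L" by (rule group_hom.axioms(1)[OF group_hom])
    have "\<exists>g\<in>L. g x = y" if xy: "x \<in> \<Omega>" "y \<in> \<Omega>" for x y
    proof -
      obtain g h where g: "g \<in> carrier (perm_group \<Omega> L)" "g z = x"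
        and h: "h \<in> carrier (perm_group \<Omega> L)" "h z = y"
        using J(3)[OF xy(1)] J(3)[OF xy(2)] Jz by blast
      let ?k = "h \<otimes>\<^bsub>perm_group \<Omega> L\<^esub> inv\<^bsub>perm_group \<Omega> L\<^esub> g"
      have "?k x = y"
        unfolding composition_rule[OF xy(1) h(1) P.inv_closed[OF g(1)]]
          orbit_sym_aux[OF g(1) z(1) g(2)] by (rule h(2))
      moreover have "?k \<in> carrier (perm_group \<Omega> L)"
        by (intro P.m_closed P.inv_closed g h)
      then have "?k \<in> L" unfolding carr .
      ultimately show ?thesis by (rule bexI)
    qed
    then have "perm_transitive \<Omega> L" unfolding perm_transitive_iff[OF assms(2)] by blast
    then show False using assms(3) by simp
  qed
  then obtain z' where z': "z' \<in> J" "z \<noteq> z'" by blast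
  have faithful: "g = \<one>\<^bsub>perm_group \<Omega> L\<^esub>"
    if "g \<in> carrier (perm_group \<Omega> L)" "\<And>x. x \<in> \<Omega> \<Longrightarrow> g x = x" for g
    using that LB by (auto simp: BijGroup_simps id_Bij intro!: Bij_eqI[of _ \<Omega>])
  \<comment> \<open>Since \<open>n\<close> is arbitrary, taking it to be the constant
    \<open>c\<close> from \<open>graph_restrictive\<close> contradicts the bound.\<close>
  have "\<exists>(\<Gamma> :: nat pair_pre_digraph) A. locally_pair \<Omega> L \<Gamma> A \<and>
     (\<exists>v\<in>pverts \<Gamma>. n < card (point_stabilizer (pverts \<Gamma>) A v))" for n
  proof -
    interpret intransitive_nonsemiregular "perm_group \<Omega> L" \<Omega> "\<lambda>g. g" J z z' p n
      by unfold_locales (use finL assms(1) faithful J z' p in auto)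
    show ?thesis using exists_large_locally_pair by simp
  qed
  moreover obtain c where "\<forall>(\<Gamma> :: nat pair_pre_digraph) A. locally_pair \<Omega> L \<Gamma> A \<longrightarrow>
     (\<forall>v\<in>pverts \<Gamma>. card (point_stabilizer (pverts \<Gamma>) A v) \<le> c)"
    using assms(4) unfolding graph_restrictive_def by blast
  ultimately show False by (meson not_le)
qed

end
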